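(* As $n\to\infty$, we have $$F_n(f)-I_n(f)+I_n(f_1)-F_n(f_1)=\mathcal O(\log n),$$ and, for any fixed $\beta\in(0,1)$ and integer $m\ge1$, $$F_n(f)-I_n(f)+I_n^{\beta}(f_m)-F_n^{\beta}(f_m)=\begin{cases}\mathcal O(\log n), & m=1,\\ \mathcal O(1), & m\ge2.\end{cases}$$
   Context: Let $\Phi=\{\mathbf b_1,\dots,\mathbf b_{|\Phi|}\}$ be a finite collection of nonzero vectors in a two-dimensional real vector space generating a lattice $\Lambda=\mathbb Z\Phi$ of full rank, with $\{\mathbf b_1,\mathbf b_2\}$ a basis of $\Lambda$. Write $\mathbf b_\ell=s_{1,\ell}\mathbf b_1+s_{2,\ell}\mathbf b_2$ and $\mathbf s_\ell=(s_{1,\ell},s_{2,\ell})\in\mathbb Z^2\setminus\{\mathbf 0\}$, so $\mathbf s_1=(1,0)$, $\mathbf s_2=(0,1)$. $\Phi$ is fixed; implied constants may depend on it (and on $\beta,m$). Let $\overline s=\max_{\ell}\|\mathbf s_\ell\|$ (Euclidean norm). For $\mathbf x\in\mathbb R^2$ and integers $m\ge1$ put $$\psi(\mathbf x)=1-\frac1{|\Phi|}\sum_{\ell=1}^{|\Phi|}\cos(\mathbf s_\ell\cdot\mathbf x),\qquad p_m(\mathbf x)=\frac1{|\Phi|}\sum_{\ell=1}^{|\Phi|}\sum_{j=1}^m\frac{(-1)^{j+1}(\mathbf s_\ell\cdot\mathbf x)^{2j}}{(2j)!},\qquad f=\frac1\psi,\qquad f_m=\frac1{p_m}.$$ For a positive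 integer $n$ let $\Delta_n=2\pi/n$, $t_j=2\pi j/n$ and $x_j=t_j-\pi/n$ ($j\in\mathbb Z$), $\mathbf t_{j,k}=(t_j,t_k)$, $X_{j,k}=[x_j,x_{j+1}]\times[x_k,x_{k+1}]$, and $$D_n=\bigcup_{\mathbf t_{j,k}\in[-\pi,\pi)^2\setminus\{\mathbf 0\}}X_{j,k},\qquad D_n^\beta=\bigcup_{|t_j|,|t_k|\le \sqrt{5(1-\beta)}/\overline s,\ (t_j,t_k)\ne(0,0)}X_{j,k}.$$ For a function $g$ define $$F_n(g)=\sum_{\mathbf t_{j,k}\in D_n}g(\mathbf t_{j,k}),\quad I_n(g)=\frac1{\Delta_n^2}\iint_{D_n}g(\mathbf x)\,d\mathbf x,\quad F_n^\beta(g)=\sum_{\mathbf t_{j,k}\in D_n^\beta}g(\mathbf t_{j,k}),\quad I_n^\beta(g)=\frac1{\Delta_n^2}\iint_{D_n^\beta}g(\mathbf x)\,d\mathbf x .$$ *)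

theory Defs
  imports
    "HOL-Analysis.Analysis"
    "HOL-Library.Landau_Symbols"
    "HOL-Computational_Algebra.Group_Closure"
begin

text \<open>The lattice \<open>\<int>\<Phi>\<close> is the additive subgroup \<^term>\<open>group_closure \<Phi>\<close>. Independence
  and span below are over the reals, so a lattice of full rank is the integer span of a real
  basis of the space.\<close>

definition lattice_basis :: "'v::real_vector set \<Rightarrow> 'v set \<Rightarrow> bool" where
  "lattice_basis B L \<longleftrightarrow> independent B \<and> group_closure B = L"

definition full_rank_lattice :: "'v::real_vector set \<Rightarrow> bool" where
  "full_rank_lattice L \<longleftrightarrow> (\<exists>B. lattice_basis B L \<and> span B = UNIV)"

text \<open>In what follows \<open>N = |\<Phi>|\<close>, and \<open>s l\<close> (for \<open>1 \<le> l \<le> N\<close>) is the pair of integer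
  coordinates of the \<open>l\<close>-th vector with respect to the first two.\<close>

definition coord_vec :: "int \<times> int \<Rightarrow> real \<times> real" where
  "coord_vec z = (real_of_int (fst z), real_of_int (snd z))"

definition s_max :: "nat \<Rightarrow> (nat \<Rightarrow> int \<times> int) \<Rightarrow> real" where
  "s_max N s = Max ((\<lambda>l. norm (coord_vec (s l))) ` {1..N})"

definition psi :: "nat \<Rightarrow> (nat \<Rightarrow> int \<times> int) \<Rightarrow> real \<times> real \<Rightarrow> real" where
  "psi N s x = 1 - 1 / real N * (\<Sum>l=1..N. cos (coord_vec (s l) \<bullet> x))"

definition p_trunc :: "nat \<Rightarrow> (nat \<Rightarrow> int \<times> int) \<Rightarrow> nat \<Rightarrow> real \<times> real \<Rightarrow> real" where
  "p_trunc N s m x = 1 / real N *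
     (\<Sum>l=1..N. \<Sum>j=1..m. (- 1) ^ (j + 1) * (coord_vec (s l) \<bullet> x) ^ (2 * j) / fact (2 * j))"

definition f_full :: "nat \<Rightarrow> (nat \<Rightarrow> int \<times> int) \<Rightarrow> real \<times> real \<Rightarrow> real" where
  "f_full N s x = 1 / psi N s x"

definition f_trunc :: "nat \<Rightarrow> (nat \<Rightarrow> int \<times> int) \<Rightarrow> nat \<Rightarrow> real \<times> real \<Rightarrow> real" where
  "f_trunc N s m x = 1 / p_trunc N s m x"

definition mesh :: "nat \<Rightarrow> real" where
  "mesh n = 2 * pi / real n"

definition t_pt :: "nat \<Rightarrow> int \<Rightarrow> real" where
  "t_pt n j = 2 * pi * real_of_int j / real n"

definition x_pt :: "nat \<Rightarrow> int \<Rightarrow> real" where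
  "x_pt n j = t_pt n j - pi / real n"

definition t_grid :: "nat \<Rightarrow> int \<Rightarrow> int \<Rightarrow> real \<times> real" where
  "t_grid n j k = (t_pt n j, t_pt n k)"

definition cell :: "nat \<Rightarrow> int \<Rightarrow> int \<Rightarrow> (real \<times> real) set" where
  "cell n j k = {x_pt n j..x_pt n (j + 1)} \<times> {x_pt n k..x_pt n (k + 1)}"

definition D_full :: "nat \<Rightarrow> (real \<times> real) set" where
  "D_full n = \<Union> {cell n j k | j k. t_grid n j k \<in> {-pi..<pi} \<times> {-pi..<pi} - {0}}"

definition D_beta :: "nat \<Rightarrow> (nat \<Rightarrow> int \<times> int) \<Rightarrow> real \<Rightarrow> nat \<Rightarrow> (real \<times> real) set" where
  "D_beta N s \<beta> n = \<Union> {cell n j k | j k.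
      \<bar>t_pt n j\<bar> \<le> sqrt (5 * (1 - \<beta>)) / s_max N s \<and>
      \<bar>t_pt n k\<bar> \<le> sqrt (5 * (1 - \<beta>)) / s_max N s \<and>
      (t_pt n j, t_pt n k) \<noteq> (0, 0)}"

definition grid_sum :: "nat \<Rightarrow> (real \<times> real) set \<Rightarrow> (real \<times> real \<Rightarrow> real) \<Rightarrow> real" where
  "grid_sum n D g = (\<Sum>p \<in> {t_grid n j k | j k. t_grid n j k \<in> D}. g p)"

definition grid_int :: "nat \<Rightarrow> (real \<times> real) set \<Rightarrow> (real \<times> real \<Rightarrow> real) \<Rightarrow> real" where
  "grid_int n D g = 1 / (mesh n)\<^sup>2 * integral D g"

definition F_full :: "nat \<Rightarrow> (real \<times> real \<Rightarrow> real) \<Rightarrow> real" where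
  "F_full n g = grid_sum n (D_full n) g"

definition I_full :: "nat \<Rightarrow> (real \<times> real \<Rightarrow> real) \<Rightarrow> real" where
  "I_full n g = grid_int n (D_full n) g"

definition F_beta ::
  "nat \<Rightarrow> (nat \<Rightarrow> int \<times> int) \<Rightarrow> real \<Rightarrow> nat \<Rightarrow> (real \<times> real \<Rightarrow> real) \<Rightarrow> real" where
  "F_beta N s \<beta> n g = grid_sum n (D_beta N s \<beta> n) g"

definition I_beta ::
  "nat \<Rightarrow> (nat \<Rightarrow> int \<times> int) \<Rightarrow> real \<Rightarrow> nat \<Rightarrow> (real \<times> real \<Rightarrow> real) \<Rightarrow> real" where
  "I_beta N s \<beta> n g = grid_int n (D_beta N s \<beta> n) g"

end

theory Submission
  imports Defs
begin

text \<open>On a cell with centre \<open>t\<close> the error of the midpoint rule is controlled by the symmetric second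
  differences \<open>g (t + h) + g (t - h) - 2 g t\<close>, hence by the second directional derivatives of \<open>g\<close>.
  Call \<open>g\<close> of order \<open>a\<close> if its \<open>i\<close>-th directional derivatives are \<open>O(|x|\<^sup>a\<^sup>-\<^sup>i)\<close> for \<open>i \<le> 2\<close>. Orders add
  under products, and reciprocals of functions bounded below by \<open>c |x|\<^sup>a\<close> have order \<open>-a\<close>. Since \<open>\<psi>\<close> and
  \<open>p\<^sub>m\<close> have order \<open>2\<close> and \<open>p\<^sub>m - \<psi>\<close> has order \<open>2m + 2\<close>, the difference
  \<open>f - f\<^sub>m = (p\<^sub>m - \<psi>) / (\<psi> p\<^sub>m)\<close> has order \<open>2m - 2\<close>. For \<open>m = 1\<close> the cell \<open>(j, k)\<close> therefore contributes
  \<open>O(max(|j|, |k|)\<^sup>-\<^sup>2)\<close>, which sums to \<open>O(log n)\<close>; for \<open>m \<ge> 2\<close> each of the \<open>O(n\<^sup>2)\<close> cells contributes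
  \<open>O(n\<^sup>-\<^sup>2)\<close>, as do the cells away from the origin for \<open>f\<close> alone.\<close>

section \<open>Functions of symbol type\<close>

text \<open>Here \<open>u1 h x\<close> and \<open>u2 h x\<close> are the first and second derivatives of \<open>u\<close> at \<open>x\<close> in direction \<open>h\<close>.
  At \<open>x = 0\<close> the bounds degenerate because \<open>0 powr a = 0\<close>; the sets \<open>A\<close> of interest omit the origin.\<close>

definition jet_bound ::
  "'a::real_normed_vector set \<Rightarrow> real \<Rightarrow> ('a \<Rightarrow> real) \<Rightarrow> ('a \<Rightarrow> 'a \<Rightarrow> real) \<Rightarrow> ('a \<Rightarrow> 'a \<Rightarrow> real) \<Rightarrow> real \<Rightarrow> bool"
where
  "jet_bound A a u u1 u2 C \<longleftrightarrow> continuous_on A u \<and> 0 \<le> C \<and> (\<forall>x\<in>A. \<forall>h.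
     ((\<lambda>r. u (x + r *\<^sub>R h)) has_real_derivative u1 h x) (at 0) \<and>
     ((\<lambda>r. u1 h (x + r *\<^sub>R h)) has_real_derivative u2 h x) (at 0) \<and>
     \<bar>u x\<bar> \<le> C * norm x powr a \<and>
     \<bar>u1 h x\<bar> \<le> C * norm x powr (a - 1) * norm h \<and>
     \<bar>u2 h x\<bar> \<le> C * norm x powr (a - 2) * (norm h)\<^sup>2)"

definition symbol :: "'a::real_normed_vector set \<Rightarrow> real \<Rightarrow> ('a \<Rightarrow> real) \<Rightarrow> bool" where
  "symbol A a u \<longleftrightarrow> (\<exists>u1 u2 C. jet_bound A a u u1 u2 C)"

lemma symbolI: "jet_bound A a u u1 u2 C \<Longrightarrow> symbol A a u"
  unfolding symbol_def by blast

lemma jet_boundI: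
  assumes "continuous_on A u" "0 \<le> C"
    and "\<And>x h. x \<in> A \<Longrightarrow> ((\<lambda>r. u (x + r *\<^sub>R h)) has_real_derivative u1 h x) (at 0)"
    and "\<And>x h. x \<in> A \<Longrightarrow> ((\<lambda>r. u1 h (x + r *\<^sub>R h)) has_real_derivative u2 h x) (at 0)"
    and "\<And>x. x \<in> A \<Longrightarrow> \<bar>u x\<bar> \<le> C * norm x powr a"
    and "\<And>x h. x \<in> A \<Longrightarrow> \<bar>u1 h x\<bar> \<le> C * norm x powr (a - 1) * norm h"
    and "\<And>x h. x \<in> A \<Longrightarrow> \<bar>u2 h x\<bar> \<le> C * norm x powr (a - 2) * (norm h)\<^sup>2"
  shows "jet_bound A a u u1 u2 C"
  unfolding jet_bound_def using assms by simp

lemma jet_boundD: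
  assumes "jet_bound A a u u1 u2 C"
  shows "continuous_on A u" "0 \<le> C"
    and "x \<in> A \<Longrightarrow> ((\<lambda>r. u (x + r *\<^sub>R h)) has_real_derivative u1 h x) (at 0)"
    and "x \<in> A \<Longrightarrow> ((\<lambda>r. u1 h (x + r *\<^sub>R h)) has_real_derivative u2 h x) (at 0)"
    and "x \<in> A \<Longrightarrow> \<bar>u x\<bar> \<le> C * norm x powr a"
    and "x \<in> A \<Longrightarrow> \<bar>u1 h x\<bar> \<le> C * norm x powr (a - 1) * norm h"
    and "x \<in> A \<Longrightarrow> \<bar>u2 h x\<bar> \<le> C * norm x powr (a - 2) * (norm h)\<^sup>2"
  using assms by (simp_all add: jet_bound_def)

lemma symbol_continuous: "symbol A a u \<Longrightarrow> continuous_on A u"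
  by (auto simp: symbol_def jet_bound_def)

lemma symbol_subset: "symbol A a u \<Longrightarrow> B \<subseteq> A \<Longrightarrow> symbol B a u"
  unfolding symbol_def jet_bound_def by (elim exE) (intro exI, auto intro: continuous_on_subset)

lemma symbol_zero: "symbol A a (\<lambda>x. 0)"
  by (rule symbolI[where C = 0 and ?u1.0 = "\<lambda>_ _. 0" and ?u2.0 = "\<lambda>_ _. 0"]) (simp add: jet_bound_def)

lemma symbol_add:
  assumes "symbol A a u" "symbol A a v"
  shows "symbol A a (\<lambda>x. u x + v x)"
proof -
  obtain u1 u2 C where "jet_bound A a u u1 u2 C"
    using assms(1) unfolding symbol_def by blast
  note u = jet_boundD[OF this]
  obtain v1 v2 D where "jet_bound A a v v1 v2 D"
    using assms(2) unfolding symbol_def by blast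
  note v = jet_boundD[OF this]
  show ?thesis
  proof (rule symbolI, rule jet_boundI[where C = "C + D" and ?u1.0 = "\<lambda>h x. u1 h x + v1 h x"
        and ?u2.0 = "\<lambda>h x. u2 h x + v2 h x"])
    show "continuous_on A (\<lambda>x. u x + v x)"
      using u v by (intro continuous_intros)
    fix x h :: 'a assume x: "x \<in> A"
    show "((\<lambda>r. u (x + r *\<^sub>R h) + v (x + r *\<^sub>R h)) has_real_derivative u1 h x + v1 h x) (at 0)"
      using u(3) v(3) x by (intro DERIV_add)
    show "((\<lambda>r. u1 h (x + r *\<^sub>R h) + v1 h (x + r *\<^sub>R h)) has_real_derivative u2 h x + v2 h x) (at 0)"
      using u(4) v(4) x by (intro DERIV_add)
    show "\<bar>u x + v x\<bar> \<le> (C + D) * norm x powr a"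
      using u(5)[OF x] v(5)[OF x] by (simp add: distrib_right)
    show "\<bar>u1 h x + v1 h x\<bar> \<le> (C + D) * norm x powr (a - 1) * norm h"
      using u(6)[OF x, of h] v(6)[OF x, of h] by (simp add: distrib_right)
    show "\<bar>u2 h x + v2 h x\<bar> \<le> (C + D) * norm x powr (a - 2) * (norm h)\<^sup>2"
      using u(7)[OF x, of h] v(7)[OF x, of h] by (simp add: distrib_right)
  qed (use u v in simp)
qed

lemma symbol_cmult:
  assumes "symbol A a u"
  shows "symbol A a (\<lambda>x. c * u x)"
proof -
  obtain u1 u2 C where "jet_bound A a u u1 u2 C"
    using assms unfolding symbol_def by blast
  note u = jet_boundD[OF this]
  show ?thesis
  proof (rule symbolI, rule jet_boundI[where C = "\<bar>c\<bar> * C" and ?u1.0 = "\<lambda>h x. c * u1 h x"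
        and ?u2.0 = "\<lambda>h x. c * u2 h x"])
    show "continuous_on A (\<lambda>x. c * u x)"
      using u by (intro continuous_intros)
    fix x h :: 'a assume x: "x \<in> A"
    show "((\<lambda>r. c * u (x + r *\<^sub>R h)) has_real_derivative c * u1 h x) (at 0)"
      using u(3) x by (intro DERIV_cmult)
    show "((\<lambda>r. c * u1 h (x + r *\<^sub>R h)) has_real_derivative c * u2 h x) (at 0)"
      using u(4) x by (intro DERIV_cmult)
    show "\<bar>c * u x\<bar> \<le> \<bar>c\<bar> * C * norm x powr a"
      using mult_left_mono[OF u(5)[OF x], of "\<bar>c\<bar>"] by (simp add: abs_mult mult.assoc)
    show "\<bar>c * u1 h x\<bar> \<le> \<bar>c\<bar> * C * norm x powr (a - 1) * norm h"
      using mult_left_mono[OF u(6)[OF x], of "\<bar>c\<bar>" h] by (simp add: abs_mult mult.assoc)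
    show "\<bar>c * u2 h x\<bar> \<le> \<bar>c\<bar> * C * norm x powr (a - 2) * (norm h)\<^sup>2"
      using mult_left_mono[OF u(7)[OF x], of "\<bar>c\<bar>" h] by (simp add: abs_mult mult.assoc)
  qed (use u in simp)
qed

lemma symbol_sum:
  assumes "\<And>i. i \<in> I \<Longrightarrow> symbol A a (u i)"
  shows "symbol A a (\<lambda>x. \<Sum>i\<in>I. u i x)"
  using assms
  by (induction I rule: infinite_finite_induct) (auto intro: symbol_zero symbol_add)

text \<open>By the Leibniz rule the second derivative is a sum of four products, each of order
  \<open>a + b - 2\<close> with constant \<open>C * D\<close>; the factor 4 then suffices for all
  three bounds.\<close>

lemma symbol_mult:
  assumes "symbol A a u" "symbol A b v"
  shows "symbol A (a + b) (\<lambda>x. u x * v x)"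
proof -
  obtain u1 u2 C where "jet_bound A a u u1 u2 C"
    using assms(1) unfolding symbol_def by blast
  note u = jet_boundD[OF this]
  obtain v1 v2 D where "jet_bound A b v v1 v2 D"
    using assms(2) unfolding symbol_def by blast
  note v = jet_boundD[OF this]
  \<comment> \<open>One estimate serves every Leibniz product: the orders \<open>c\<close>,
    \<open>d\<close> and the degrees \<open>i\<close>, \<open>j\<close> in \<open>h\<close> add
    up.\<close>
  have prod_le: "\<bar>p * q\<bar> \<le> C * D * norm x powr (c + d) * norm h ^ (i + j)"
    if "\<bar>p\<bar> \<le> C * norm x powr c * norm h ^ i" "\<bar>q\<bar> \<le> D * norm x powr d * norm h ^ j"
    for p q c d i j and x h :: 'a
    using mult_mono[OF that] u(2) by (simp add: abs_mult powr_add power_add mult_ac)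
  show ?thesis
  proof (rule symbolI, rule jet_boundI[where C = "4 * (C * D)" and ?u1.0 = "\<lambda>h x. u1 h x * v x + v1 h x * u x"
        and ?u2.0 = "\<lambda>h x. (u2 h x * v x + v1 h x * u1 h x) + (v2 h x * u x + u1 h x * v1 h x)"])
    show "continuous_on A (\<lambda>x. u x * v x)"
      using u v by (intro continuous_intros)
    fix x h :: 'a assume x: "x \<in> A"
    have CD: "0 \<le> C * D * norm x powr c" "0 \<le> C * D * norm x powr c * norm h" for c
      using u(2) v(2) by auto
    note d = u(3)[OF x, of h] v(3)[OF x, of h] u(4)[OF x, of h] v(4)[OF x, of h]
    show "((\<lambda>r. u (x + r *\<^sub>R h) * v (x + r *\<^sub>R h)) has_real_derivative u1 h x * v x + v1 h x * u x) (at 0)"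
      using DERIV_mult[OF d(1,2)] by simp
    show "((\<lambda>r. u1 h (x + r *\<^sub>R h) * v (x + r *\<^sub>R h) + v1 h (x + r *\<^sub>R h) * u (x + r *\<^sub>R h))
      has_real_derivative (u2 h x * v x + v1 h x * u1 h x) + (v2 h x * u x + u1 h x * v1 h x)) (at 0)"
      using DERIV_add[OF DERIV_mult[OF d(3,2)] DERIV_mult[OF d(4,1)]] by simp
    show "\<bar>u x * v x\<bar> \<le> 4 * (C * D) * norm x powr (a + b)"
      using prod_le[of "u x" x a h 0 "v x" b 0] u(5)[OF x] v(5)[OF x] CD(1)[of "a + b"] by simp
    have "\<bar>u1 h x * v x\<bar> \<le> C * D * norm x powr (a + b - 1) * norm h"
      using prod_le[of "u1 h x" x "a - 1" h 1 "v x" b 0] u(6)[OF x, of h] v(5)[OF x]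
      by (simp add: algebra_simps)
    moreover have "\<bar>u x * v1 h x\<bar> \<le> C * D * norm x powr (a + b - 1) * norm h"
      using prod_le[of "u x" x a h 0 "v1 h x" "b - 1" 1] v(6)[OF x, of h] u(5)[OF x]
      by (simp add: algebra_simps)
    ultimately show "\<bar>u1 h x * v x + v1 h x * u x\<bar> \<le> 4 * (C * D) * norm x powr (a + b - 1) * norm h"
      using CD(2)[of "a + b - 1"] by (simp add: mult.commute[of "v1 h x"])
    have "\<bar>u2 h x * v x\<bar> \<le> C * D * norm x powr (a + b - 2) * (norm h)\<^sup>2"
      using prod_le[of "u2 h x" x "a - 2" h 2 "v x" b 0] u(7)[OF x, of h] v(5)[OF x]
      by (simp add: algebra_simps power2_eq_square)
    moreover have "\<bar>u x * v2 h x\<bar> \<le> C * D * norm x powr (a + b - 2) * (norm h)\<^sup>2"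
      using prod_le[of "u x" x a h 0 "v2 h x" "b - 2" 2] v(7)[OF x, of h] u(5)[OF x]
      by (simp add: algebra_simps power2_eq_square)
    moreover have "\<bar>u1 h x * v1 h x\<bar> \<le> C * D * norm x powr (a + b - 2) * (norm h)\<^sup>2"
      using prod_le[of "u1 h x" x "a - 1" h 1 "v1 h x" "b - 1" 1] v(6)[OF x, of h] u(6)[OF x, of h]
      by (simp add: algebra_simps power2_eq_square)
    ultimately show "\<bar>(u2 h x * v x + v1 h x * u1 h x) + (v2 h x * u x + u1 h x * v1 h x)\<bar>
        \<le> 4 * (C * D) * norm x powr (a + b - 2) * (norm h)\<^sup>2"
      by (simp add: mult.commute[of "v1 h x"] mult.commute[of "v2 h x"])
  qed (use u v in simp)
qed

text \<open>The derivatives of \<open>1 / u\<close> are \<open>- u1 / u^2\<close> and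
  \<open>2 * u1^2 / u^3 - u2 / u^2\<close>. By the lower bound on \<open>u\<close>, each division by
  \<open>u\<close> lowers the order by \<open>a\<close>, which gives orders \<open>- a - 1\<close>
  and \<open>- a - 2\<close>.\<close>

lemma symbol_inverse:
  assumes "symbol A a u" "c > 0" "0 \<notin> A" "\<And>x. x \<in> A \<Longrightarrow> c * norm x powr a \<le> u x"
  shows "symbol A (- a) (\<lambda>x. 1 / u x)"
proof -
  obtain u1 u2 C where "jet_bound A a u u1 u2 C"
    using assms(1) unfolding symbol_def by blast
  note u = jet_boundD[OF this]
  have pos: "u x > 0" if "x \<in> A" for x
  proof -
    have "norm x powr a > 0" using that assms(3) by auto
    then show ?thesis using assms(4)[OF that] assms(2) by (smt (verit) mult_pos_pos)
  qed
  \<comment> \<open>One summand per kind of term: \<open>1 / c\<close> for the value,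
    \<open>C / c^2\<close> for \<open>u1 / u^2\<close> and \<open>u2 / u^2\<close>, and
    \<open>2 * C^2 / c^3\<close> for the squared first derivative.\<close>
  define K where "K = 1 / c + C / c\<^sup>2 + 2 * C\<^sup>2 / c ^ 3"
  have K: "1 / c \<le> K" "C / c\<^sup>2 \<le> K" "C / c\<^sup>2 + 2 * C\<^sup>2 / c ^ 3 \<le> K" "0 \<le> K"
    using assms(2) u(2) by (auto simp: K_def)
  show ?thesis
  proof (rule symbolI, rule jet_boundI[where C = K and ?u1.0 = "\<lambda>h x. - u1 h x / (u x)\<^sup>2"
        and ?u2.0 = "\<lambda>h x. 2 * (u1 h x)\<^sup>2 / (u x) ^ 3 - u2 h x / (u x)\<^sup>2"])
    show "continuous_on A (\<lambda>x. 1 / u x)"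
      using u pos by (intro continuous_intros) (auto simp: less_le)
    fix x h :: 'a assume x: "x \<in> A"
    define w where "w = norm x powr a"
    have w: "w > 0" using x assms(3) by (auto simp: w_def)
    have nx: "norm x > 0" using x assms(3) by auto
    have cw: "c * w \<le> u x" "0 < c * w" using assms(4)[OF x] w assms(2) by (auto simp: w_def)
    have inv: "1 / (u x) ^ i \<le> 1 / (c ^ i * w ^ i)" for i
      using power_mono[OF cw(1), of i] cw w assms(2)
      by (intro divide_left_mono) (auto simp: power_mult_distrib pos[OF x])
    have pw: "norm x powr (a - d) = w / norm x powr d" for d
      by (simp add: w_def powr_diff)
    have pm: "norm x powr (- a) = 1 / w" "norm x powr (- a - d) = 1 / w / norm x powr d" for d
      by (simp_all add: w_def powr_diff powr_minus divide_simps)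
    note d = u(3)[OF x, of h] u(4)[OF x, of h]
    have ux: "u x \<noteq> 0" using pos[OF x] by simp
    show "((\<lambda>r. 1 / u (x + r *\<^sub>R h)) has_real_derivative - u1 h x / (u x)\<^sup>2) (at 0)"
      using ux by (auto intro!: derivative_eq_intros d simp: power2_eq_square)
    show "((\<lambda>r. - u1 h (x + r *\<^sub>R h) / (u (x + r *\<^sub>R h))\<^sup>2) has_real_derivative
        2 * (u1 h x)\<^sup>2 / (u x) ^ 3 - u2 h x / (u x)\<^sup>2) (at 0)"
      using ux by (auto intro!: derivative_eq_intros d simp: field_simps eval_nat_numeral)
    have "\<bar>1 / u x\<bar> \<le> 1 / c * (1 / w)"
      using inv[of 1] pos[OF x] by simp
    also have "\<dots> \<le> K * (1 / w)"
      using K(1) w by (intro mult_right_mono) auto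
    finally show "\<bar>1 / u x\<bar> \<le> K * norm x powr (- a)"
      by (simp add: pm)
    have "\<bar>u1 h x\<bar> * (1 / (u x)\<^sup>2) \<le> (C * (w / norm x) * norm h) * (1 / (c\<^sup>2 * w\<^sup>2))"
      using u(6)[OF x, of h] inv[of 2] pw[of 1] u(2) w nx by (intro mult_mono) auto
    also have "\<dots> = (C / c\<^sup>2) * (1 / w / norm x * norm h)"
      using w by (simp add: power2_eq_square divide_simps)
    also have "\<dots> \<le> K * (1 / w / norm x * norm h)"
      using K(2) w nx by (intro mult_right_mono) auto
    finally show "\<bar>- u1 h x / (u x)\<^sup>2\<bar> \<le> K * norm x powr (- a - 1) * norm h"
      using pm(2)[of 1] by (simp add: abs_mult)
    have "\<bar>u1 h x\<bar>\<^sup>2 \<le> (C * (w / norm x) * norm h)\<^sup>2"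
      using u(6)[OF x, of h] pw[of 1] by (intro power_mono) auto
    then have "(2 * (u1 h x)\<^sup>2) * (1 / (u x) ^ 3) \<le> (2 * (C * (w / norm x) * norm h)\<^sup>2) * (1 / (c ^ 3 * w ^ 3))"
      using inv[of 3] pos[OF x] by (intro mult_mono) auto
    also have "\<dots> = (2 * C\<^sup>2 / c ^ 3) * (1 / w / (norm x)\<^sup>2 * (norm h)\<^sup>2)"
      using w by (simp add: eval_nat_numeral divide_simps)
    finally have 1: "2 * (u1 h x)\<^sup>2 / (u x) ^ 3 \<le> (2 * C\<^sup>2 / c ^ 3) * (1 / w / (norm x)\<^sup>2 * (norm h)\<^sup>2)"
      by simp
    have "\<bar>u2 h x\<bar> * (1 / (u x)\<^sup>2) \<le> (C * (w / (norm x)\<^sup>2) * (norm h)\<^sup>2) * (1 / (c\<^sup>2 * w\<^sup>2))"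
      using u(7)[OF x, of h] inv[of 2] pw[of 2] u(2) w nx by (intro mult_mono) auto
    also have "\<dots> = (C / c\<^sup>2) * (1 / w / (norm x)\<^sup>2 * (norm h)\<^sup>2)"
      using w by (simp add: power2_eq_square divide_simps)
    finally have 2: "\<bar>u2 h x / (u x)\<^sup>2\<bar> \<le> (C / c\<^sup>2) * (1 / w / (norm x)\<^sup>2 * (norm h)\<^sup>2)"
      by (simp add: abs_mult)
    have "\<bar>2 * (u1 h x)\<^sup>2 / (u x) ^ 3\<bar> = 2 * (u1 h x)\<^sup>2 / (u x) ^ 3"
      using pos[OF x] by simp
    then have "\<bar>2 * (u1 h x)\<^sup>2 / (u x) ^ 3 - u2 h x / (u x)\<^sup>2\<bar>
        \<le> (2 * C\<^sup>2 / c ^ 3) * (1 / w / (norm x)\<^sup>2 * (norm h)\<^sup>2) + (C / c\<^sup>2) * (1 / w / (norm x)\<^sup>2 * (norm h)\<^sup>2)"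
      using 1 2 by linarith
    also have "\<dots> = (C / c\<^sup>2 + 2 * C\<^sup>2 / c ^ 3) * (1 / w / (norm x)\<^sup>2 * (norm h)\<^sup>2)"
      by (subst add.commute) (rule distrib_right[symmetric])
    also have "\<dots> \<le> K * (1 / w / (norm x)\<^sup>2 * (norm h)\<^sup>2)"
      using K(3) w by (intro mult_right_mono) auto
    finally show "\<bar>2 * (u1 h x)\<^sup>2 / (u x) ^ 3 - u2 h x / (u x)\<^sup>2\<bar> \<le> K * norm x powr (- a - 2) * (norm h)\<^sup>2"
      using pm(2)[of 2] nx by simp
  qed (fact K(4))
qed

text \<open>All three bounds gain the same factor \<open>norm x powr (a - b)\<close>, so a single
  bound for it is enough. On bounded sets this lowers the order; away from the origin it can also
  raise it.\<close>

lemma symbol_change_order: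
  assumes "symbol A a u" "\<And>x. x \<in> A \<Longrightarrow> norm x powr (a - b) \<le> K"
  shows "symbol A b u"
proof -
  obtain u1 u2 C where "jet_bound A a u u1 u2 C"
    using assms(1) unfolding symbol_def by blast
  note u = jet_boundD[OF this]
  have le: "C * norm x powr (a - d) \<le> C * \<bar>K\<bar> * norm x powr (b - d)" if "x \<in> A" for x d
  proof -
    have "norm x powr (a - d) = norm x powr (a - b) * norm x powr (b - d)"
      by (simp flip: powr_add)
    also have "\<dots> \<le> \<bar>K\<bar> * norm x powr (b - d)"
      using assms(2)[OF that] by (intro mult_right_mono) auto
    finally show ?thesis
      using u(2) by (simp add: mult.assoc mult_left_mono)
  qed
  show ?thesis
  proof (rule symbolI, rule jet_boundI[where C = "C * \<bar>K\<bar>", OF u(1) _ u(3,4)])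
    fix x h :: 'a assume x: "x \<in> A"
    show "\<bar>u x\<bar> \<le> C * \<bar>K\<bar> * norm x powr b"
      using le[OF x, of 0] u(5)[OF x] by simp
    show "\<bar>u1 h x\<bar> \<le> C * \<bar>K\<bar> * norm x powr (b - 1) * norm h"
      using mult_right_mono[OF le[OF x, of 1], of "norm h"] u(6)[OF x, of h] by simp
    show "\<bar>u2 h x\<bar> \<le> C * \<bar>K\<bar> * norm x powr (b - 2) * (norm h)\<^sup>2"
      using mult_right_mono[OF le[OF x, of 2], of "(norm h)\<^sup>2"] u(7)[OF x, of h] by simp
  qed (use u in auto)
qed

text \<open>Chain rule along lines and Cauchy-Schwarz. Each derivative trades one factor
  \<open>norm s * norm x\<close> for \<open>norm s * norm h\<close>, so the degree in
  \<open>s\<close> stays \<open>k + 2\<close> and one constant serves all three bounds.\<close>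

lemma symbol_ridge:
  fixes s :: "'a::real_inner"
  assumes "\<And>y. (r has_real_derivative r1 y) (at y)" "\<And>y. (r1 has_real_derivative r2 y) (at y)"
    and "\<And>y. \<bar>r y\<bar> \<le> \<bar>y\<bar> ^ (k + 2)" "\<And>y. \<bar>r1 y\<bar> \<le> \<bar>y\<bar> ^ (k + 1)" "\<And>y. \<bar>r2 y\<bar> \<le> \<bar>y\<bar> ^ k"
    and "0 \<notin> A"
  shows "symbol A (real k + 2) (\<lambda>x. r (s \<bullet> x))"
proof (rule symbolI, rule jet_boundI[where C = "norm s ^ (k + 2)" and ?u1.0 = "\<lambda>h x. r1 (s \<bullet> x) * (s \<bullet> h)"
      and ?u2.0 = "\<lambda>h x. r2 (s \<bullet> x) * (s \<bullet> h) * (s \<bullet> h)"])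
  have "continuous_on UNIV r"
    using assms(1) by (meson DERIV_isCont continuous_at_imp_continuous_on)
  then show "continuous_on A (\<lambda>x. r (s \<bullet> x))"
    by (rule continuous_on_compose2) (auto intro!: continuous_intros)
  fix x h :: 'a assume x: "x \<in> A"
  then have nx: "norm x > 0" using assms(6) by auto
  have pow: "\<bar>s \<bullet> x\<bar> ^ i \<le> norm s ^ i * norm x powr (real i)" for i
    using power_mono[OF Cauchy_Schwarz_ineq2, of s x i] nx
    by (simp add: powr_realpow power_mult_distrib)
  have sh: "\<bar>s \<bullet> h\<bar> \<le> norm s * norm h"
    by (rule Cauchy_Schwarz_ineq2)
  have line: "((\<lambda>r. s \<bullet> (x + r *\<^sub>R h)) has_real_derivative s \<bullet> h) (at 0)"
    by (auto intro!: derivative_eq_intros simp: inner_add_right)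
  have "(r has_real_derivative r1 (s \<bullet> x)) (at (s \<bullet> (x + 0 *\<^sub>R h)))"
    using assms(1) by simp
  from DERIV_chain2[OF this line]
  show "((\<lambda>t. r (s \<bullet> (x + t *\<^sub>R h))) has_real_derivative r1 (s \<bullet> x) * (s \<bullet> h)) (at 0)" .
  have "(r1 has_real_derivative r2 (s \<bullet> x)) (at (s \<bullet> (x + 0 *\<^sub>R h)))"
    using assms(2) by simp
  from DERIV_cmult_right[OF DERIV_chain2[OF this line], of "s \<bullet> h"]
  show "((\<lambda>t. r1 (s \<bullet> (x + t *\<^sub>R h)) * (s \<bullet> h)) has_real_derivative r2 (s \<bullet> x) * (s \<bullet> h) * (s \<bullet> h)) (at 0)" .
  show "\<bar>r (s \<bullet> x)\<bar> \<le> norm s ^ (k + 2) * norm x powr (real k + 2)"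
    using order_trans[OF assms(3) pow] by (simp add: add_ac)
  have "\<bar>r1 (s \<bullet> x)\<bar> * \<bar>s \<bullet> h\<bar> \<le> (norm s ^ (k + 1) * norm x powr (real k + 1)) * (norm s * norm h)"
    using order_trans[OF assms(4) pow] sh by (intro mult_mono) (auto simp: add_ac)
  then show "\<bar>r1 (s \<bullet> x) * (s \<bullet> h)\<bar> \<le> norm s ^ (k + 2) * norm x powr (real k + 2 - 1) * norm h"
    by (simp add: abs_mult mult_ac add_ac)
  have "\<bar>r2 (s \<bullet> x)\<bar> * \<bar>s \<bullet> h\<bar> * \<bar>s \<bullet> h\<bar> \<le> (norm s ^ k * norm x powr real k) * (norm s * norm h) * (norm s * norm h)"
    using order_trans[OF assms(5) pow] sh by (intro mult_mono) auto
  then show "\<bar>r2 (s \<bullet> x) * (s \<bullet> h) * (s \<bullet> h)\<bar> \<le> norm s ^ (k + 2) * norm x powr (real k + 2 - 2) * (norm h)\<^sup>2"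
    by (simp add: abs_mult mult_ac power2_eq_square)
qed auto

text \<open>The mean value inequality is used twice: \<open>p t + p (- t)\<close> has derivative
  \<open>p1 t - p1 (- t)\<close>, which is itself at most \<open>M * 2\<close> on the
  interval.\<close>

lemma second_difference_bound:
  fixes p :: "real \<Rightarrow> real"
  assumes "\<And>t. \<bar>t\<bar> \<le> 1 \<Longrightarrow> (p has_real_derivative p1 t) (at t)"
    and "\<And>t. \<bar>t\<bar> \<le> 1 \<Longrightarrow> (p1 has_real_derivative p2 t) (at t)"
    and "\<And>t. \<bar>t\<bar> \<le> 1 \<Longrightarrow> \<bar>p2 t\<bar> \<le> M"
  shows "\<bar>p 1 + p (- 1) - 2 * p 0\<bar> \<le> 2 * M"
proof -
  have p1: "\<bar>p1 t - p1 (- t)\<bar> \<le> 2 * M" if "t \<in> {-1..1}" for t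
  proof -
    have "norm (p1 t - p1 (- t)) \<le> M * norm (t - - t)"
      by (rule field_differentiable_bound[of "{-1..1}" p1 p2])
        (use assms(2,3) that in \<open>auto intro: has_field_derivative_at_within\<close>)
    also have "\<dots> \<le> M * 2"
      using that assms(3)[of 0] by (intro mult_left_mono) auto
    finally show ?thesis by simp
  qed
  have "norm ((p 1 + p (- 1)) - (p 0 + p (- 0))) \<le> (2 * M) * norm (1 - (0::real))"
  proof (rule field_differentiable_bound[of "{-1..1}" "\<lambda>t. p t + p (- t)" "\<lambda>t. p1 t - p1 (- t)"])
    fix t :: real assume "t \<in> {-1..1}"
    then have "(p has_real_derivative p1 t) (at t)" "(p has_real_derivative p1 (- t)) (at (- t))"
      using assms(1) by auto
    then have "((\<lambda>t. p t + p (- t)) has_real_derivative p1 t - p1 (- t)) (at t)"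
      by (auto intro!: derivative_eq_intros DERIV_chain2[of p])
    then show "((\<lambda>t. p t + p (- t)) has_field_derivative p1 t - p1 (- t)) (at t within {-1..1})"
      by (rule has_field_derivative_at_within)
  qed (use p1 in auto)
  then show ?thesis by simp
qed

text \<open>The previous lemma is applied to \<open>p t = u (x + t h)\<close>. Since
  \<open>K\<close> is chosen after \<open>C\<close>, every grid cell may later supply its own bound
  for the weight.\<close>

lemma symbol_second_difference:
  assumes "symbol A a u"
  shows "\<exists>C\<ge>0. \<forall>x h K. (\<forall>t. \<bar>t\<bar> \<le> 1 \<longrightarrow> x + t *\<^sub>R h \<in> A \<and> norm (x + t *\<^sub>R h) powr (a - 2) \<le> K)
    \<longrightarrow> \<bar>u (x + h) + u (x - h) - 2 * u x\<bar> \<le> C * K * (norm h)\<^sup>2"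
proof -
  obtain u1 u2 C where "jet_bound A a u u1 u2 C"
    using assms unfolding symbol_def by blast
  note u = jet_boundD[OF this]
  have "\<bar>u (x + h) + u (x - h) - 2 * u x\<bar> \<le> (2 * C) * K * (norm h)\<^sup>2"
    if xh: "\<forall>t. \<bar>t\<bar> \<le> 1 \<longrightarrow> x + t *\<^sub>R h \<in> A \<and> norm (x + t *\<^sub>R h) powr (a - 2) \<le> K" for x h K
  proof -
    \<comment> \<open>\<open>jet_bound\<close> speaks of derivatives at parameter 0 only; moving the
      base point along the line gives them at parameter \<open>t\<close>.\<close>
    have shift: "((\<lambda>r. w (x + r *\<^sub>R h)) has_real_derivative d) (at t)"
      if "((\<lambda>r. w (x + t *\<^sub>R h + r *\<^sub>R h)) has_real_derivative d) (at 0)" for w :: "'a \<Rightarrow> real" and t d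
      using that DERIV_shift[of "\<lambda>r. w (x + r *\<^sub>R h)" d 0 t] by (simp add: algebra_simps)
    have "\<bar>u (x + 1 *\<^sub>R h) + u (x + (- 1) *\<^sub>R h) - 2 * u (x + 0 *\<^sub>R h)\<bar> \<le> 2 * (C * K * (norm h)\<^sup>2)"
    proof (rule second_difference_bound[where ?p1.0 = "\<lambda>t. u1 h (x + t *\<^sub>R h)" and ?p2.0 = "\<lambda>t. u2 h (x + t *\<^sub>R h)"])
      fix t :: real assume "\<bar>t\<bar> \<le> 1"
      then have t: "x + t *\<^sub>R h \<in> A" "norm (x + t *\<^sub>R h) powr (a - 2) \<le> K" using xh by auto
      show "((\<lambda>t. u (x + t *\<^sub>R h)) has_real_derivative u1 h (x + t *\<^sub>R h)) (at t)"
        by (rule shift[OF u(3)[OF t(1)]])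
      show "((\<lambda>t. u1 h (x + t *\<^sub>R h)) has_real_derivative u2 h (x + t *\<^sub>R h)) (at t)"
        by (rule shift[OF u(4)[OF t(1)]])
      have "C * norm (x + t *\<^sub>R h) powr (a - 2) * (norm h)\<^sup>2 \<le> C * K * (norm h)\<^sup>2"
        using t u(2) by (intro mult_right_mono mult_left_mono) auto
      then show "\<bar>u2 h (x + t *\<^sub>R h)\<bar> \<le> C * K * (norm h)\<^sup>2"
        using u(7)[OF t(1), of h] by linarith
    qed
    then show ?thesis by simp
  qed
  then show ?thesis
    using u(2) by (intro exI[of _ "2 * C"]) auto
qed

section \<open>The midpoint rule on a punctured grid\<close>

lemma midpoint_error_cbox:
  fixes g :: "'a::euclidean_space \<Rightarrow> real"
  assumes cont: "continuous_on (cbox (c - r) (c + r)) g"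
    and B: "\<And>h. c + h \<in> cbox (c - r) (c + r) \<Longrightarrow> \<bar>g (c + h) + g (c - h) - 2 * g c\<bar> \<le> B" "0 \<le> B"
  shows "\<bar>2 * integral (cbox (c - r) (c + r)) g - 2 * (measure lborel (cbox (c - r) (c + r)) * g c)\<bar>
    \<le> B * measure lborel (cbox (c - r) (c + r))"
proof -
  \<comment> \<open>The box is symmetric about \<open>c\<close>, so \<open>g\<close> may be averaged with its reflection, which cancels the
    first-order term.\<close>
  let ?Q = "cbox (c - r) (c + r)"
  have g: "(g has_integral integral ?Q g) ?Q"
    using integrable_continuous[OF cont] by (rule integrable_integral)
  have img: "(\<lambda>x. 2 *\<^sub>R c - x) ` ?Q = ?Q"
  proof (intro equalityI subsetI)
    show "x \<in> ?Q" if "x \<in> (\<lambda>x. 2 *\<^sub>R c - x) ` ?Q" for x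
      using that by (fastforce simp: mem_box inner_diff_left inner_add_left)
    show "x \<in> (\<lambda>x. 2 *\<^sub>R c - x) ` ?Q" if "x \<in> ?Q" for x
    proof (rule image_eqI)
      show "2 *\<^sub>R c - x \<in> ?Q"
        using that by (fastforce simp: mem_box inner_diff_left inner_add_left)
    qed simp
  qed
  have "((\<lambda>x. g (2 *\<^sub>R c - x)) has_integral integral ?Q g) ?Q"
    using has_integral_affinity[OF g, of "- 1" "2 *\<^sub>R c"] img by (simp add: add.commute)
  then have "((\<lambda>x. g x + g (2 *\<^sub>R c - x) - 2 * g c) has_integral
      (integral ?Q g + integral ?Q g - measure lborel ?Q * (2 * g c))) ?Q"
    using g has_integral_const[of "2 * g c" "c - r" "c + r"]
    by (intro has_integral_diff has_integral_add) simp_all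
  then have "norm (integral ?Q g + integral ?Q g - measure lborel ?Q * (2 * g c)) \<le> B * measure lborel ?Q"
  proof (rule has_integral_bound[OF B(2)])
    fix x assume "x \<in> ?Q"
    then show "norm (g x + g (2 *\<^sub>R c - x) - 2 * g c) \<le> B"
      using B(1)[of "x - c"] by (simp add: scaleR_2 algebra_simps)
  qed
  then show ?thesis by (simp add: algebra_simps)
qed

section \<open>Nodes, cells and the quadrature error of a cell\<close>

abbreviation node :: "nat \<Rightarrow> int \<times> int \<Rightarrow> real \<times> real" where
  "node n p \<equiv> t_grid n (fst p) (snd p)"

abbreviation node_cell :: "nat \<Rightarrow> int \<times> int \<Rightarrow> (real \<times> real) set" where
  "node_cell n p \<equiv> cell n (fst p) (snd p)"

lemma node_cell_eq_cbox:
  "node_cell n p = cbox (node n p - (pi / real n, pi / real n)) (node n p + (pi / real n, pi / real n))"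
proof -
  have "x_pt n (j + 1) = t_pt n j + pi / real n" for j
    by (simp add: x_pt_def t_pt_def algebra_simps add_divide_distrib)
  then show ?thesis
    unfolding cell_def t_grid_def by (simp only:) (simp add: cbox_Pair_eq x_pt_def)
qed

lemma mem_node_cell:
  "x \<in> node_cell n p \<longleftrightarrow>
     \<bar>fst x - t_pt n (fst p)\<bar> \<le> pi / real n \<and> \<bar>snd x - t_pt n (snd p)\<bar> \<le> pi / real n"
  by (cases x) (auto simp: node_cell_eq_cbox t_grid_def cbox_Pair_eq abs_le_iff)

lemma measure_node_cell: "measure lborel (node_cell n p) = (mesh n)\<^sup>2"
  unfolding node_cell_eq_cbox t_grid_def mesh_def
  by (simp add: content_Pair power2_eq_square)

text \<open>The contribution of one cell to \<open>F_n(g) - I_n(g)\<close>. As \<open>mesh^2\<close>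
  is the area of the cell, the subtracted term is the mean of \<open>g\<close> over it.\<close>

definition quad_err :: "nat \<Rightarrow> (real \<times> real \<Rightarrow> real) \<Rightarrow> int \<times> int \<Rightarrow> real" where
  "quad_err n g p = g (node n p) - 1 / (mesh n)\<^sup>2 * integral (node_cell n p) g"

lemma quad_err_bound:
  assumes "n > 0" "continuous_on (node_cell n p) g" "0 \<le> B"
    and "\<And>h. node n p + h \<in> node_cell n p \<Longrightarrow> \<bar>g (node n p + h) + g (node n p - h) - 2 * g (node n p)\<bar> \<le> B"
  shows "\<bar>quad_err n g p\<bar> \<le> B"
proof -
  have m: "(mesh n)\<^sup>2 > 0" using assms(1) by (simp add: mesh_def)
  have "\<bar>2 * integral (node_cell n p) g - 2 * (measure lborel (node_cell n p) * g (node n p))\<bar>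
      \<le> B * measure lborel (node_cell n p)"
    using midpoint_error_cbox[OF assms(2)[unfolded node_cell_eq_cbox] _ assms(3)]
      assms(4)[unfolded node_cell_eq_cbox] by (simp add: node_cell_eq_cbox)
  then have *: "\<bar>2 * integral (node_cell n p) g - 2 * ((mesh n)\<^sup>2 * g (node n p))\<bar> \<le> B * (mesh n)\<^sup>2"
    by (simp add: measure_node_cell)
  have "2 * integral (node_cell n p) g - 2 * ((mesh n)\<^sup>2 * g (node n p)) = - 2 * quad_err n g p * (mesh n)\<^sup>2"
    using m by (simp add: quad_err_def field_simps)
  then have "2 * \<bar>quad_err n g p\<bar> * (mesh n)\<^sup>2 \<le> B * (mesh n)\<^sup>2"
    using * by (simp add: abs_mult)
  then have "2 * \<bar>quad_err n g p\<bar> \<le> B"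
    using m by (simp add: mult_le_cancel_right)
  then show ?thesis by simp
qed

lemma t_pt_dist: "n > 0 \<Longrightarrow> j \<noteq> k \<Longrightarrow> \<bar>t_pt n j - t_pt n k\<bar> \<ge> 2 * pi / real n"
proof -
  assume "n > 0" "j \<noteq> k"
  then have "\<bar>real_of_int (j - k)\<bar> \<ge> 1" by linarith
  then have "2 * pi / real n * 1 \<le> 2 * pi / real n * \<bar>real_of_int (j - k)\<bar>"
    by (intro mult_left_mono) auto
  also have "\<dots> = \<bar>2 * pi / real n * real_of_int (j - k)\<bar>"
    by (simp add: abs_mult)
  also have "2 * pi / real n * real_of_int (j - k) = t_pt n j - t_pt n k"
    by (simp add: t_pt_def algebra_simps diff_divide_distrib)
  finally show ?thesis by simp
qed

lemma node_in_node_cell_iff: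
  assumes "n > 0"
  shows "node n p \<in> node_cell n q \<longleftrightarrow> p = q"
proof -
  have lt: "pi / real n < 2 * pi / real n" using assms by (simp add: field_simps)
  have "\<bar>t_pt n j - t_pt n k\<bar> \<le> pi / real n \<longleftrightarrow> j = k" for j k
  proof (cases "j = k")
    case False
    then show ?thesis using t_pt_dist[OF assms False] lt by linarith
  qed simp
  then show ?thesis
    by (simp add: mem_node_cell t_grid_def prod_eq_iff)
qed

text \<open>Closed neighbouring cells share edges or corners, which must not disturb additivity of
  the integral. Distinct cells differ in some index, and their common points lie on a line halfway
  between the two centres in that coordinate.\<close>

lemma negligible_node_cell_Int:
  assumes "n > 0" "p \<noteq> q"
  shows "negligible (node_cell n p \<inter> node_cell n q)"
proof -
  \<comment> \<open>The centres are at least \<open>2 * pi / n\<close> apart and the radii are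
    \<open>pi / n\<close>, so both distance bounds are attained.\<close>
  have mid: "x = (t_pt n j + t_pt n k) / 2"
    if "\<bar>x - t_pt n j\<bar> \<le> pi / real n" "\<bar>x - t_pt n k\<bar> \<le> pi / real n" "j \<noteq> k" for x j k
    using t_pt_dist[OF assms(1) that(3)] that(1,2) by (simp add: abs_le_iff) linarith
  consider "fst p \<noteq> fst q" | "snd p \<noteq> snd q" using assms(2) by (auto simp: prod_eq_iff)
  then show ?thesis
  proof cases
    case 1
    have "negligible {x :: real \<times> real. x \<bullet> (1, 0) = (t_pt n (fst p) + t_pt n (fst q)) / 2}"
      by (rule negligible_standard_hyperplane) (simp add: Basis_prod_def)
    then show ?thesis
    proof (rule negligible_subset, intro subsetI)
      fix x assume "x \<in> node_cell n p \<inter> node_cell n q"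
      then have "fst x = (t_pt n (fst p) + t_pt n (fst q)) / 2"
        by (intro mid[OF _ _ 1]) (auto simp: mem_node_cell)
      then show "x \<in> {x. x \<bullet> (1, 0) = (t_pt n (fst p) + t_pt n (fst q)) / 2}"
        by (simp add: inner_prod_def)
    qed
  next
    case 2
    have "negligible {x :: real \<times> real. x \<bullet> (0, 1) = (t_pt n (snd p) + t_pt n (snd q)) / 2}"
      by (rule negligible_standard_hyperplane) (simp add: Basis_prod_def)
    then show ?thesis
    proof (rule negligible_subset, intro subsetI)
      fix x assume "x \<in> node_cell n p \<inter> node_cell n q"
      then have "snd x = (t_pt n (snd p) + t_pt n (snd q)) / 2"
        by (intro mid[OF _ _ 2]) (auto simp: mem_node_cell)
      then show "x \<in> {x. x \<bullet> (0, 1) = (t_pt n (snd p) + t_pt n (snd q)) / 2}"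
        by (simp add: inner_prod_def)
    qed
  qed
qed

text \<open>Overlaps of cells are null sets, so the integral splits over \<open>T\<close>. No cell
  contains a node other than its own, so the nodes in the union are exactly those indexed by
  \<open>T\<close>, without repetition.\<close>

lemma grid_sum_minus_grid_int:
  assumes "n > 0" "finite T" "\<And>p. p \<in> T \<Longrightarrow> continuous_on (node_cell n p) g"
  shows "grid_sum n (\<Union>p\<in>T. node_cell n p) g - grid_int n (\<Union>p\<in>T. node_cell n p) g
    = (\<Sum>p\<in>T. quad_err n g p)"
proof -
  have "(g has_integral (\<Sum>p\<in>T. integral (node_cell n p) g)) (\<Union>p\<in>T. node_cell n p)"
  proof (rule has_integral_UN[OF assms(2)])
    fix p assume "p \<in> T"
    then have "g integrable_on node_cell n p"
      using assms(3) unfolding node_cell_eq_cbox by (intro integrable_continuous) blast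
    then show "(g has_integral integral (node_cell n p) g) (node_cell n p)"
      by (rule integrable_integral)
  qed (auto simp: pairwise_def intro: negligible_node_cell_Int[OF assms(1)])
  then have I: "integral (\<Union>p\<in>T. node_cell n p) g = (\<Sum>p\<in>T. integral (node_cell n p) g)"
    by (rule integral_unique)
  have "{t_grid n j k | j k. t_grid n j k \<in> (\<Union>p\<in>T. node_cell n p)} = node n ` T"
  proof -
    have "t_grid n j k \<in> (\<Union>p\<in>T. node_cell n p) \<longleftrightarrow> (j, k) \<in> T" for j k
      using node_in_node_cell_iff[OF assms(1), of "(j, k)"] by auto
    then have "{t_grid n j k | j k. t_grid n j k \<in> (\<Union>p\<in>T. node_cell n p)} = {t_grid n j k | j k. (j, k) \<in> T}"
      by simp
    also have "\<dots> = node n ` T"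
      by force
    finally show ?thesis .
  qed
  moreover have "inj_on (node n) T"
  proof (rule inj_onI)
    fix p q assume "node n p = node n q"
    then have "node n p \<in> node_cell n q" using node_in_node_cell_iff[OF assms(1), of q q] by simp
    then show "p = q" using node_in_node_cell_iff[OF assms(1)] by blast
  qed
  ultimately have "grid_sum n (\<Union>p\<in>T. node_cell n p) g = (\<Sum>p\<in>T. g (node n p))"
    by (simp add: grid_sum_def sum.reindex)
  then show ?thesis
    by (simp add: grid_int_def I quad_err_def sum_subtractf sum_distrib_left)
qed

lemma quad_err_diff:
  assumes "continuous_on (node_cell n p) f" "continuous_on (node_cell n p) g"
  shows "quad_err n (\<lambda>x. f x - g x) p = quad_err n f p - quad_err n g p"
proof -
  have "f integrable_on node_cell n p" "g integrable_on node_cell n p"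
    using assms unfolding node_cell_eq_cbox by (intro integrable_continuous; simp)+
  then show ?thesis
    by (simp add: quad_err_def integral_diff right_diff_distrib)
qed

text \<open>The sup norm is preferred to the Euclidean one because its level sets are square rings,
  whose points can be counted exactly.\<close>

definition sup_index :: "int \<times> int \<Rightarrow> real" where
  "sup_index p = real_of_int (max \<bar>fst p\<bar> \<bar>snd p\<bar>)"

lemma sup_index_ge_1: "p \<noteq> 0 \<Longrightarrow> sup_index p \<ge> 1"
  by (cases p) (auto simp: sup_index_def zero_prod_def)

text \<open>For \<open>j\<close> nonzero, \<open>|t_j| = 2 * |j| * pi / n\<close>, and a point of
  the cell is off by at most \<open>pi / n\<close>; at least \<open>|j| * pi / n\<close> remains
  because \<open>|j| >= 1\<close>. In particular these cells miss the origin.\<close>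

lemma norm_node_cell_ge:
  assumes "n > 0" "p \<noteq> 0" "x \<in> node_cell n p"
  shows "pi / real n * sup_index p \<le> norm x"
proof -
  have *: "pi / real n * real_of_int \<bar>j\<bar> \<le> \<bar>y\<bar>"
    if "\<bar>y - t_pt n j\<bar> \<le> pi / real n" "j \<noteq> 0" for j y
  proof -
    define a where "a = pi / real n"
    have "\<bar>t_pt n j\<bar> = a * (2 * real_of_int \<bar>j\<bar>)"
      by (simp add: t_pt_def abs_mult a_def)
    moreover have "a * (1 + real_of_int \<bar>j\<bar>) \<le> a * (2 * real_of_int \<bar>j\<bar>)"
      using that(2) by (intro mult_left_mono) (auto simp: a_def)
    ultimately have "a + a * real_of_int \<bar>j\<bar> \<le> \<bar>t_pt n j\<bar>"
      by (simp add: distrib_left)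
    then show ?thesis using that(1) unfolding a_def[symmetric] by linarith
  qed
  have "\<bar>fst x\<bar> \<le> norm x" "\<bar>snd x\<bar> \<le> norm x"
    using norm_fst_le[of "fst x" "snd x"] norm_snd_le[of "snd x" "fst x"] by auto
  moreover have "pi / real n * sup_index p \<le> \<bar>fst x\<bar> \<or> pi / real n * sup_index p \<le> \<bar>snd x\<bar>"
  proof (cases "\<bar>fst p\<bar> \<ge> \<bar>snd p\<bar>")
    case True
    then have "fst p \<noteq> 0" "sup_index p = real_of_int \<bar>fst p\<bar>"
      using assms(2) by (auto simp: sup_index_def prod_eq_iff)
    then show ?thesis using *[of "fst x" "fst p"] assms(3) by (auto simp: mem_node_cell)
  next
    case False
    then have "snd p \<noteq> 0" "sup_index p = real_of_int \<bar>snd p\<bar>"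
      by (auto simp: sup_index_def prod_eq_iff)
    then show ?thesis using *[of "snd x" "snd p"] assms(3) by (auto simp: mem_node_cell)
  qed
  ultimately show ?thesis by linarith
qed

lemma node_cell_segment:
  assumes "node n p + h \<in> node_cell n p" "\<bar>t\<bar> \<le> 1"
  shows "node n p + t *\<^sub>R h \<in> node_cell n p"
proof -
  have "\<bar>t * y\<bar> \<le> \<bar>y\<bar>" for y
    using assms(2) by (simp add: abs_mult mult_left_le_one_le)
  then show ?thesis
    using assms(1) by (auto simp: mem_node_cell t_grid_def intro: order_trans)
qed

lemma norm_offset_le:
  assumes "node n p + h \<in> node_cell n p"
  shows "(norm h)\<^sup>2 \<le> 2 * (pi / real n)\<^sup>2"
proof -
  have "\<bar>fst h\<bar> \<le> pi / real n" "\<bar>snd h\<bar> \<le> pi / real n"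
    using assms by (auto simp: mem_node_cell t_grid_def)
  from this[THEN power_mono, of 2]
  have "(fst h)\<^sup>2 \<le> (pi / real n)\<^sup>2" "(snd h)\<^sup>2 \<le> (pi / real n)\<^sup>2"
    by simp_all
  then show ?thesis by (simp add: norm_prod_def)
qed

text \<open>The segment of offsets \<open>t h\<close> stays inside the cell, so the second
  difference estimate applies with the cell's own \<open>K\<close>. The half-diagonal satisfies
  \<open>(norm h)^2 <= 2 * (pi / n)^2\<close>, which doubles the constant.\<close>

lemma symbol_quad_err:
  assumes "symbol A a g"
  shows "\<exists>C\<ge>0. \<forall>n>0. \<forall>p K. node_cell n p \<subseteq> A \<longrightarrow> (\<forall>x\<in>node_cell n p. norm x powr (a - 2) \<le> K)
    \<longrightarrow> \<bar>quad_err n g p\<bar> \<le> C * K * (pi / real n)\<^sup>2"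
proof -
  obtain C where C: "C \<ge> 0" "\<And>x h K. (\<forall>t. \<bar>t\<bar> \<le> 1 \<longrightarrow> x + t *\<^sub>R h \<in> A \<and> norm (x + t *\<^sub>R h) powr (a - 2) \<le> K)
    \<Longrightarrow> \<bar>g (x + h) + g (x - h) - 2 * g x\<bar> \<le> C * K * (norm h)\<^sup>2"
    using symbol_second_difference[OF assms] by blast
  have "\<bar>quad_err n g p\<bar> \<le> (2 * C) * K * (pi / real n)\<^sup>2"
    if n: "n > 0" and sub: "node_cell n p \<subseteq> A" and K: "\<forall>x\<in>node_cell n p. norm x powr (a - 2) \<le> K" for n p K
  proof (rule quad_err_bound[OF n])
    show "continuous_on (node_cell n p) g"
      using symbol_continuous[OF assms] sub by (rule continuous_on_subset)
    have "node n p \<in> node_cell n p" using node_in_node_cell_iff[OF n] by simp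
    then have K0: "K \<ge> 0" using K by (meson order_trans powr_ge_zero)
    then show "0 \<le> 2 * C * K * (pi / real n)\<^sup>2" using C(1) by simp
    fix h assume h: "node n p + h \<in> node_cell n p"
    have "\<bar>g (node n p + h) + g (node n p - h) - 2 * g (node n p)\<bar> \<le> C * K * (norm h)\<^sup>2"
      using node_cell_segment[OF h] sub K by (intro C(2)) blast
    also have "\<dots> \<le> C * K * (2 * (pi / real n)\<^sup>2)"
      using norm_offset_le[OF h] C(1) K0 by (intro mult_left_mono) auto
    finally show "\<bar>g (node n p + h) + g (node n p - h) - 2 * g (node n p)\<bar> \<le> 2 * C * K * (pi / real n)\<^sup>2"
      by simp
  qed
  then show ?thesis using C(1) by (intro exI[of _ "2 * C"]) auto
qed

text \<open>Second derivatives are of size \<open>|x|^(-2)\<close>, and on the cell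
  \<open>norm_node_cell_ge\<close> controls this weight. The factors \<open>(pi / n)^2\<close>
  cancel, so the bound depends on the index alone.\<close>

lemma quad_err_symbol_0:
  assumes "symbol A 0 g"
  shows "\<exists>C\<ge>0. \<forall>n>0. \<forall>p. p \<noteq> 0 \<longrightarrow> node_cell n p \<subseteq> A \<longrightarrow> \<bar>quad_err n g p\<bar> \<le> C / (sup_index p)\<^sup>2"
proof -
  obtain C where C: "C \<ge> 0" "\<And>n p K. n > 0 \<Longrightarrow> node_cell n p \<subseteq> A \<Longrightarrow>
      (\<forall>x\<in>node_cell n p. norm x powr (- 2) \<le> K) \<Longrightarrow> \<bar>quad_err n g p\<bar> \<le> C * K * (pi / real n)\<^sup>2"
    using symbol_quad_err[OF assms] by auto
  have "\<bar>quad_err n g p\<bar> \<le> C / (sup_index p)\<^sup>2"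
    if n: "n > 0" and p: "p \<noteq> 0" and sub: "node_cell n p \<subseteq> A" for n p
  proof -
    let ?K = "1 / (pi / real n * sup_index p)\<^sup>2"
    have pos: "pi / real n * sup_index p > 0"
      using n sup_index_ge_1[OF p] by (intro mult_pos_pos) auto
    have "norm x powr (- 2) \<le> ?K" if "x \<in> node_cell n p" for x
    proof -
      have "norm x powr (- 2) = 1 / (norm x)\<^sup>2"
        using less_le_trans[OF pos norm_node_cell_ge[OF n p that]] by (simp add: powr_minus divide_inverse)
      also have "\<dots> \<le> ?K"
        using n pos norm_node_cell_ge[OF n p that] less_le_trans[OF pos norm_node_cell_ge[OF n p that]] sup_index_ge_1[OF p]
        by (intro divide_left_mono power_mono mult_pos_pos zero_less_power) (auto intro: less_le_trans)
      finally show ?thesis .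
    qed
    then have "\<bar>quad_err n g p\<bar> \<le> C * ?K * (pi / real n)\<^sup>2"
      by (intro C(2)[OF n sub]) blast
    also have "\<dots> = C / (sup_index p)\<^sup>2"
      using n by (simp add: field_simps)
    finally show ?thesis .
  qed
  then show ?thesis using C(1) by blast
qed

text \<open>Order 2 means bounded second derivatives, so only the squared cell size
  survives.\<close>

lemma quad_err_symbol_2:
  assumes "symbol A 2 g"
  shows "\<exists>C\<ge>0. \<forall>n>0. \<forall>p. node_cell n p \<subseteq> A \<longrightarrow> \<bar>quad_err n g p\<bar> \<le> C / (real n)\<^sup>2"
proof -
  obtain C where C: "C \<ge> 0" "\<And>n p K. n > 0 \<Longrightarrow> node_cell n p \<subseteq> A \<Longrightarrow>
      (\<forall>x\<in>node_cell n p. norm x powr 0 \<le> K) \<Longrightarrow> \<bar>quad_err n g p\<bar> \<le> C * K * (pi / real n)\<^sup>2"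
    using symbol_quad_err[OF assms] by auto
  have "\<bar>quad_err n g p\<bar> \<le> C * pi\<^sup>2 / (real n)\<^sup>2" if "n > 0" "node_cell n p \<subseteq> A" for n p
    using C(2)[OF that, of 1] by (simp add: power_divide)
  then show ?thesis using C(1) by (intro exI[of _ "C * pi\<^sup>2"]) auto
qed

section \<open>Summation of the cell errors\<close>

definition index_box :: "nat \<Rightarrow> (int \<times> int) set" where
  "index_box n = {- int n..int n} \<times> {- int n..int n}"

lemma finite_index_box [simp]: "finite (index_box n)"
  by (simp add: index_box_def)

lemma card_index_box: "card (index_box n) = (2 * n + 1)\<^sup>2"
proof -
  have "nat (int n + 1 + int n) = 2 * n + 1" by simp
  then show ?thesis by (simp add: index_box_def card_cartesian_product power2_eq_square)
qed

text \<open>Induction over square rings: the ring at sup distance \<open>k\<close> has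
  \<open>8 * k\<close> points, each contributing \<open>1 / k^2\<close>, so the sum is 8 times a
  harmonic sum.\<close>

lemma sum_inverse_square_sup_index:
  "n \<ge> 1 \<Longrightarrow> (\<Sum>p\<in>index_box n - {0}. 1 / (sup_index p)\<^sup>2) \<le> 8 * (1 + ln (real n))"
proof (induction n rule: nat_induct_at_least)
  case base
  have "(\<Sum>p\<in>index_box 1 - {0}. 1 / (sup_index p)\<^sup>2) \<le> (\<Sum>p\<in>index_box 1 - {0}. 1)"
    using sup_index_ge_1 by (intro sum_mono) (auto simp: divide_le_eq_1 one_le_power)
  also have "\<dots> = 8"
    by (simp add: card_Diff_singleton_if card_index_box) (simp add: index_box_def zero_prod_def)
  finally show ?case by simp
next
  case (Suc n)
  have sub: "index_box n \<subseteq> index_box (Suc n)" by (auto simp: index_box_def)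
  have "card (index_box (Suc n) - index_box n) = (2 * Suc n + 1)\<^sup>2 - (2 * n + 1)\<^sup>2"
    using card_Diff_subset[OF _ sub] by (simp only: card_index_box finite_index_box)
  then have card: "card (index_box (Suc n) - index_box n) = 8 * Suc n"
    by (simp add: power2_eq_square)
  have eq: "index_box (Suc n) - {0} = (index_box n - {0}) \<union> (index_box (Suc n) - index_box n)"
    using sub by (auto simp: index_box_def zero_prod_def)
  have "(\<Sum>p\<in>index_box (Suc n) - {0}. 1 / (sup_index p)\<^sup>2)
      = (\<Sum>p\<in>index_box n - {0}. 1 / (sup_index p)\<^sup>2) + (\<Sum>p\<in>index_box (Suc n) - index_box n. 1 / (sup_index p)\<^sup>2)"
    unfolding eq by (rule sum.union_disjoint) auto
  also have "(\<Sum>p\<in>index_box (Suc n) - index_box n. 1 / (sup_index p)\<^sup>2)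
      \<le> (\<Sum>p\<in>index_box (Suc n) - index_box n. 1 / (real (Suc n))\<^sup>2)"
  proof (intro sum_mono divide_left_mono power_mono)
    fix p assume "p \<in> index_box (Suc n) - index_box n"
    then have "int (Suc n) \<le> max \<bar>fst p\<bar> \<bar>snd p\<bar>" by (auto simp: index_box_def)
    then show "real (Suc n) \<le> sup_index p" unfolding sup_index_def by linarith
    then show "0 < (sup_index p)\<^sup>2 * (real (Suc n))\<^sup>2" by (intro mult_pos_pos) auto
  qed auto
  also have "\<dots> = 8 * (1 / real (Suc n))"
    unfolding sum_constant card of_nat_mult by (simp add: power2_eq_square del: of_nat_Suc)
  \<comment> \<open>The harmonic increment is compared with the increment of the logarithm through
    \<open>ln x <= x - 1\<close> at \<open>x = n / (n + 1)\<close>.\<close>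
  also have "1 / real (Suc n) \<le> ln (real (Suc n)) - ln (real n)"
  proof -
    have "ln (real n / real (Suc n)) \<le> real n / real (Suc n) - 1"
      using Suc.hyps by (intro ln_le_minus_one) simp
    moreover have "real n / real (Suc n) - 1 = - (1 / real (Suc n))"
      by (simp add: field_simps)
    moreover have "ln (real n / real (Suc n)) = ln (real n) - ln (real (Suc n))"
      using Suc.hyps by (simp add: ln_div)
    ultimately show ?thesis by linarith
  qed
  finally show ?case using Suc.IH by simp
qed

text \<open>\<open>T\<close> is left arbitrary so that the estimate fits both grid regions; the cell
  bounds are nonnegative, so the sum may be enlarged to the whole box.\<close>

lemma sum_quad_err_symbol_0:
  assumes "symbol A 0 g"
  obtains C where "C \<ge> 0"
    and "\<forall>n>0. \<forall>T. T \<subseteq> index_box n - {0} \<longrightarrow> (\<forall>p\<in>T. node_cell n p \<subseteq> A)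
      \<longrightarrow> \<bar>\<Sum>p\<in>T. quad_err n g p\<bar> \<le> C * (1 + ln (real n))"
proof -
  obtain C where C: "C \<ge> 0" "\<And>n p. n > 0 \<Longrightarrow> p \<noteq> 0 \<Longrightarrow> node_cell n p \<subseteq> A \<Longrightarrow> \<bar>quad_err n g p\<bar> \<le> C / (sup_index p)\<^sup>2"
    using quad_err_symbol_0[OF assms] by blast
  have "\<bar>\<Sum>p\<in>T. quad_err n g p\<bar> \<le> (C * 8) * (1 + ln (real n))"
    if n: "n > 0" and T: "T \<subseteq> index_box n - {0}" and sub: "\<forall>p\<in>T. node_cell n p \<subseteq> A" for n T
  proof -
    have "\<bar>\<Sum>p\<in>T. quad_err n g p\<bar> \<le> (\<Sum>p\<in>T. C / (sup_index p)\<^sup>2)"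
      using C(2)[OF n] T sub by (intro order_trans[OF sum_abs] sum_mono) blast
    also have "\<dots> \<le> (\<Sum>p\<in>index_box n - {0}. C / (sup_index p)\<^sup>2)"
      using T C(1) by (intro sum_mono2) auto
    also have "\<dots> = C * (\<Sum>p\<in>index_box n - {0}. 1 / (sup_index p)\<^sup>2)"
      by (simp add: sum_distrib_left)
    also have "\<dots> \<le> C * (8 * (1 + ln (real n)))"
      using sum_inverse_square_sup_index[of n] n C(1) by (intro mult_left_mono) auto
    finally show ?thesis by (simp only: mult.assoc)
  qed
  then show ?thesis using C(1) by (intro that[of "C * 8"]) auto
qed

text \<open>The box has \<open>(2 * n + 1)^2 <= 9 * n^2\<close> cells, each contributing at most
  \<open>C / n^2\<close>.\<close>

lemma sum_quad_err_symbol_2: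
  assumes "symbol A 2 g"
  obtains C where "C \<ge> 0"
    and "\<forall>n>0. \<forall>T. T \<subseteq> index_box n \<longrightarrow> (\<forall>p\<in>T. node_cell n p \<subseteq> A)
      \<longrightarrow> \<bar>\<Sum>p\<in>T. quad_err n g p\<bar> \<le> C"
proof -
  obtain C where C: "C \<ge> 0" "\<And>n p. n > 0 \<Longrightarrow> node_cell n p \<subseteq> A \<Longrightarrow> \<bar>quad_err n g p\<bar> \<le> C / (real n)\<^sup>2"
    using quad_err_symbol_2[OF assms] by blast
  have "\<bar>\<Sum>p\<in>T. quad_err n g p\<bar> \<le> C * 9"
    if n: "n > 0" and T: "T \<subseteq> index_box n" and sub: "\<forall>p\<in>T. node_cell n p \<subseteq> A" for n T
  proof -
    have "\<bar>\<Sum>p\<in>T. quad_err n g p\<bar> \<le> (\<Sum>p\<in>T. C / (real n)\<^sup>2)"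
      using C(2)[OF n] T sub by (intro order_trans[OF sum_abs] sum_mono) blast
    also have "\<dots> \<le> (\<Sum>p\<in>index_box n. C / (real n)\<^sup>2)"
      using T C(1) by (intro sum_mono2) auto
    also have "\<dots> = C * ((2 * real n + 1)\<^sup>2 / (real n)\<^sup>2)"
      by (simp add: card_index_box add_ac)
    also have "\<dots> \<le> C * ((3 * real n)\<^sup>2 / (real n)\<^sup>2)"
      using n C(1) by (intro mult_left_mono divide_right_mono power_mono) auto
    also have "\<dots> = C * 9"
      using n by (simp add: power_mult_distrib)
    finally show ?thesis .
  qed
  then show ?thesis using C(1) by (intro that[of "C * 9"]) auto
qed

section \<open>Taylor truncations of the cosine sum\<close>

text \<open>The derivatives in \<open>jet_bound\<close> involve values on a line near
  \<open>x\<close> that might leave \<open>A\<close>; openness makes agreement on \<open>A\<close>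
  sufficient.\<close>

lemma symbol_cong_open:
  assumes "symbol A a u" "open A" "\<And>x. x \<in> A \<Longrightarrow> u x = v x"
  shows "symbol A a v"
proof -
  obtain u1 u2 C where "jet_bound A a u u1 u2 C"
    using assms(1) unfolding symbol_def by blast
  note u = jet_boundD[OF this]
  show ?thesis
  proof (rule symbolI, rule jet_boundI[of A v C u1 u2])
    show "continuous_on A v"
      using u(1) assms(3) by (simp cong: continuous_on_cong)
    fix x h :: 'a assume x: "x \<in> A"
    have "open ((\<lambda>r. x + r *\<^sub>R h) -` A)"
      by (intro open_vimage assms(2) continuous_intros)
    from has_field_derivative_transform_within_open[OF u(3)[OF x, of h] this]
    show "((\<lambda>r. v (x + r *\<^sub>R h)) has_real_derivative u1 h x) (at 0)"
      using x assms(3) by simp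
    show "\<bar>v x\<bar> \<le> C * norm x powr a"
      using u(5)[OF x] assms(3)[OF x] by simp
  qed (use u in auto)
qed

text \<open>The error of the Taylor polynomial of \<open>1 - cos\<close>; its average over the
  frequencies is \<open>p_m - psi\<close>. For \<open>m = 0\<close> the sum is empty and the average
  is \<open>- psi\<close>.\<close>

definition cos_rem :: "nat \<Rightarrow> real \<Rightarrow> real" where
  "cos_rem m y = (\<Sum>j=1..m. (- 1) ^ (j + 1) * y ^ (2 * j) / fact (2 * j)) - (1 - cos y)"

definition sin_rem :: "nat \<Rightarrow> real \<Rightarrow> real" where
  "sin_rem m y = (\<Sum>j=1..m. (- 1) ^ (j + 1) * y ^ (2 * j - 1) / fact (2 * j - 1)) - sin y"

lemma has_derivative_cos_rem: "(cos_rem m has_real_derivative sin_rem m y) (at y)"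
proof -
  have "((\<lambda>y. (- 1) ^ (j + 1) * y ^ (2 * j) / fact (2 * j)) has_real_derivative
      (- 1) ^ (j + 1) * y ^ (2 * j - 1) / fact (2 * j - 1)) (at y)" if "j \<in> {1..m}" for j
  proof -
    have "(fact (2 * j) :: real) = real (2 * j) * fact (2 * j - 1)"
      using that by (intro fact_reduce) auto
    then show ?thesis
      using that by (auto intro!: derivative_eq_intros simp: field_simps)
  qed
  then have "((\<lambda>y. (\<Sum>j=1..m. (- 1) ^ (j + 1) * y ^ (2 * j) / fact (2 * j)) - (1 - cos y)) has_real_derivative
      (\<Sum>j=1..m. (- 1) ^ (j + 1) * y ^ (2 * j - 1) / fact (2 * j - 1)) - (0 - (- sin y))) (at y)"
    by (intro DERIV_diff DERIV_sum DERIV_cos DERIV_const) blast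
  then show ?thesis by (simp add: cos_rem_def[abs_def] sin_rem_def)
qed

text \<open>After differentiation and an index shift, the term \<open>j = 1\<close> becomes the
  constant 1 and the other signs flip, which leaves the negated remainder with one term
  fewer.\<close>

lemma has_derivative_sin_rem_Suc: "(sin_rem (Suc m) has_real_derivative - cos_rem m y) (at y)"
proof -
  have "((\<lambda>y. (- 1) ^ (j + 1) * y ^ (2 * j - 1) / fact (2 * j - 1)) has_real_derivative
      (- 1) ^ (j + 1) * y ^ (2 * (j - 1)) / fact (2 * (j - 1))) (at y)" if "j \<in> {1..Suc m}" for j
  proof -
    have "j \<noteq> 0" using that by simp
    then obtain i where i: "j = Suc i" using not0_implies_Suc by blast
    have "((\<lambda>y. (- 1) ^ i * y ^ Suc (2 * i) / (real (Suc (2 * i)) * fact (2 * i))) has_real_derivative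
        (- 1) ^ i * (real (Suc (2 * i)) * y ^ (2 * i)) / (real (Suc (2 * i)) * fact (2 * i))) (at y)"
      by (intro DERIV_cdivide DERIV_cmult) (use DERIV_pow[of "Suc (2 * i)" y] in simp)
    moreover have "(- 1) ^ i * (real (Suc (2 * i)) * y ^ (2 * i)) / (real (Suc (2 * i)) * fact (2 * i))
        = (- 1) ^ i * y ^ (2 * i) / fact (2 * i)"
      by (simp del: of_nat_Suc)
    ultimately show ?thesis by (simp add: i)
  qed
  then have "((\<lambda>y. (\<Sum>j=1..Suc m. (- 1) ^ (j + 1) * y ^ (2 * j - 1) / fact (2 * j - 1)) - sin y) has_real_derivative
      (\<Sum>j=1..Suc m. (- 1) ^ (j + 1) * y ^ (2 * (j - 1)) / fact (2 * (j - 1))) - cos y) (at y)"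
    by (intro DERIV_diff DERIV_sum DERIV_sin) blast
  moreover have "(\<Sum>j=1..Suc m. (- 1) ^ (j + 1) * y ^ (2 * (j - 1)) / fact (2 * (j - 1))) - cos y = - cos_rem m y"
  proof -
    have "(\<Sum>j=1..Suc m. (- 1) ^ (j + 1) * y ^ (2 * (j - 1)) / fact (2 * (j - 1)))
        = (\<Sum>j=0..m. (- 1) ^ j * y ^ (2 * j) / fact (2 * j))"
      using sum.shift_bounds_cl_Suc_ivl[of "\<lambda>j. (- 1) ^ (j + 1) * y ^ (2 * (j - 1)) / fact (2 * (j - 1))" 0 m]
      by simp
    also have "\<dots> = 1 + (\<Sum>j=1..m. (- 1) ^ j * y ^ (2 * j) / fact (2 * j))"
      by (simp add: sum.atLeast_Suc_atMost)
    also have "\<dots> = 1 - (\<Sum>j=1..m. (- 1) ^ (j + 1) * y ^ (2 * j) / fact (2 * j))"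
      by (simp add: sum_negf)
    finally show ?thesis by (simp add: cos_rem_def)
  qed
  ultimately show ?thesis by (simp only: sin_rem_def[abs_def])
qed

text \<open>Mean value inequality on the interval from \<open>- |y|\<close> to \<open>|y|\<close>.
  The factor \<open>1 / (k + 1)\<close> that integration would give is dropped.\<close>

lemma abs_le_power_of_deriv:
  fixes q :: "real \<Rightarrow> real"
  assumes "\<And>y. (q has_real_derivative q' y) (at y)" "q 0 = 0" "\<And>y. \<bar>q' y\<bar> \<le> \<bar>y\<bar> ^ k"
  shows "\<bar>q y\<bar> \<le> \<bar>y\<bar> ^ Suc k"
proof -
  have "norm (q y - q 0) \<le> \<bar>y\<bar> ^ k * norm (y - 0)"
  proof (rule field_differentiable_bound[of "{- \<bar>y\<bar>..\<bar>y\<bar>}" q q'])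
    fix z assume "z \<in> {- \<bar>y\<bar>..\<bar>y\<bar>}"
    then have "\<bar>z\<bar> ^ k \<le> \<bar>y\<bar> ^ k" by (intro power_mono) auto
    then show "norm (q' z) \<le> \<bar>y\<bar> ^ k" using assms(3)[of z] by simp
  qed (use assms(1) in \<open>auto intro: has_field_derivative_at_within\<close>)
  then show ?thesis using assms(2) by (simp add: mult.commute)
qed

text \<open>Successive derivatives run from \<open>cos_rem (m + 1)\<close> over
  \<open>sin_rem (m + 1)\<close> to \<open>- cos_rem m\<close>. All of these vanish at 0, so each
  integration raises the exponent by one, starting from \<open>|sin y| <= |y|\<close>.\<close>

lemma cos_rem_sin_rem_bound:
  "(\<forall>y. \<bar>cos_rem m y\<bar> \<le> \<bar>y\<bar> ^ (2 * m + 2)) \<and> (\<forall>y. \<bar>sin_rem m y\<bar> \<le> \<bar>y\<bar> ^ (2 * m + 1))"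
proof (induction m)
  case 0
  have s: "\<bar>sin_rem 0 y\<bar> \<le> \<bar>y\<bar> ^ 1" for y
    by (simp add: sin_rem_def abs_sin_x_le_abs_x)
  have "\<bar>cos_rem 0 y\<bar> \<le> \<bar>y\<bar> ^ Suc 1" for y
    by (rule abs_le_power_of_deriv[OF has_derivative_cos_rem _ s]) (simp add: cos_rem_def)
  with s show ?case by simp
next
  case (Suc m)
  have s: "\<bar>sin_rem (Suc m) y\<bar> \<le> \<bar>y\<bar> ^ Suc (2 * m + 2)" for y
    using Suc.IH
    by (intro abs_le_power_of_deriv[OF has_derivative_sin_rem_Suc]) (auto simp: sin_rem_def power_0_left)
  have "\<bar>cos_rem (Suc m) y\<bar> \<le> \<bar>y\<bar> ^ Suc (Suc (2 * m + 2))" for y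
    by (rule abs_le_power_of_deriv[OF has_derivative_cos_rem _ s]) (auto simp: cos_rem_def power_0_left)
  with s show ?case by simp
qed

lemma symbol_cos_rem:
  fixes v :: "'a::real_inner"
  assumes "0 \<notin> A"
  shows "symbol A (real (2 * m) + 2) (\<lambda>x. cos_rem m (v \<bullet> x))"
proof (rule symbol_ridge[where ?r1.0 = "sin_rem m" and
      ?r2.0 = "case m of 0 \<Rightarrow> (\<lambda>y. - cos y) | Suc i \<Rightarrow> (\<lambda>y. - cos_rem i y)", OF has_derivative_cos_rem])
  \<comment> \<open>The second derivative is the negated remainder for \<open>m - 1\<close>, except
    at \<open>m = 0\<close>, where it is \<open>- cos\<close> and the required bound is
    \<open>|y|^0 = 1\<close>.\<close>
  show "(sin_rem m has_real_derivative (case m of 0 \<Rightarrow> (\<lambda>y. - cos y) | Suc i \<Rightarrow> (\<lambda>y. - cos_rem i y)) y) (at y)" for y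
  proof (cases m)
    case 0
    have "((\<lambda>y. - sin y) has_real_derivative - cos y) (at y)" by (intro DERIV_minus DERIV_sin)
    then show ?thesis by (simp add: 0 sin_rem_def[abs_def])
  qed (simp add: has_derivative_sin_rem_Suc)
  show "\<bar>(case m of 0 \<Rightarrow> (\<lambda>y. - cos y) | Suc i \<Rightarrow> (\<lambda>y. - cos_rem i y)) y\<bar> \<le> \<bar>y\<bar> ^ (2 * m)" for y
    using cos_rem_sin_rem_bound[of "m - 1"] by (cases m) auto
qed (use cos_rem_sin_rem_bound[of m] assms in auto)

text \<open>The range goes beyond pi because closed cells stick out of the basic square, but it
  stays away from the zeros at \<open>2 * pi\<close> and \<open>- 2 * pi\<close>. For
  \<open>|y| <= 1/2\<close> Taylor expansion suffices; otherwise \<open>1 - cos y >= 1/16\<close>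
  and \<open>y^2 <= 25\<close>, whence \<open>400 = 16 * 25\<close>.\<close>

lemma one_minus_cos_ge:
  assumes "\<bar>y\<bar> \<le> 3 * pi / 2"
  shows "y\<^sup>2 / 400 \<le> 1 - cos (y :: real)"
proof -
  have small: "z\<^sup>2 / 4 \<le> 1 - cos z" if "\<bar>z\<bar> \<le> 1 / 2" for z :: real
  proof -
    have "\<bar>z\<^sup>2 / 2 - (1 - cos z)\<bar> \<le> z\<^sup>2 * z\<^sup>2"
      using cos_rem_sin_rem_bound[of 1] by (simp add: cos_rem_def fact_2 flip: power_add)
    moreover have "z\<^sup>2 * z\<^sup>2 \<le> z\<^sup>2 * (1 / 4)"
      using power_mono[OF that, of 2] by (intro mult_left_mono) (auto simp: power_divide)
    ultimately show ?thesis by linarith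
  qed
  show ?thesis
  proof (cases "\<bar>y\<bar> \<le> 1 / 2")
    case True
    then show ?thesis using small[OF True] zero_le_power2[of y] by linarith
  next
    case False
    have half: "cos (1 / 2) \<le> 15 / (16 :: real)"
      using small[of "1 / 2"] by (simp add: power2_eq_square)
    have "cos y \<le> 15 / 16"
    proof (cases "\<bar>y\<bar> \<le> pi")
      case True
      then have "cos \<bar>y\<bar> \<le> cos (1 / 2)"
        using False by (intro cos_monotone_0_pi_le) auto
      then show ?thesis using half by simp
    next
      case False
      \<comment> \<open>Here \<open>|y| - pi\<close> lies between 0 and \<open>pi / 2\<close>, so
        \<open>cos y\<close> is nonpositive.\<close>
      have "cos (\<bar>y\<bar> - pi) \<ge> 0"
        using False assms by (intro cos_ge_zero) auto
      then show ?thesis by (simp add: cos_diff)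
    qed
    moreover have "\<bar>y\<bar>\<^sup>2 \<le> 5\<^sup>2"
      using assms pi_less_4 pi_approx by (intro power_mono) auto
    ultimately show ?thesis by simp
  qed
qed

text \<open>Consecutive terms of the alternating sum decrease from the second one on because
  \<open>y\<^sup>2 \<le> 30\<close>; the first two leave at least \<open>y\<^sup>2 / 2 - y\<^sup>4 / 24\<close>.\<close>

lemma cos_taylor_ge:
  fixes y :: real
  assumes "y\<^sup>2 \<le> 10" "m \<ge> 1"
  shows "y\<^sup>2 / 12 \<le> (\<Sum>j=1..m. (- 1) ^ (j + 1) * y ^ (2 * j) / fact (2 * j))"
proof -
  define a where "a j = y ^ (2 * j) / fact (2 * j)" for j
  define P where "P m = (\<Sum>j=1..m. (- 1) ^ (j + 1) * a j)" for m
  have a_nonneg: "0 \<le> a j" for j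
    by (simp add: a_def power_mult)
  have P_Suc: "P (Suc m) = P m + (if odd m then - a (Suc m) else a (Suc m))" for m
    by (simp add: P_def)
  have decr: "a (Suc j) \<le> a j" if "j \<ge> 2" for j
  proof -
    have "a (Suc j) = a j * (y\<^sup>2 / ((2 * real j + 2) * (2 * real j + 1)))"
      by (simp add: a_def power2_eq_square field_simps)
    also have "\<dots> \<le> a j * 1"
    proof (intro mult_left_mono a_nonneg)
      have "6 * 5 \<le> (2 * real j + 2) * (2 * real j + 1)"
        using that by (intro mult_mono) auto
      then show "y\<^sup>2 / ((2 * real j + 2) * (2 * real j + 1)) \<le> 1"
        using assms(1) by (simp add: divide_le_eq_1)
    qed
    finally show ?thesis by simp
  qed
  have a1: "a 1 = y\<^sup>2 / 2" by (simp add: a_def fact_2)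
  \<comment> \<open>The induction hypothesis is strengthened: for odd \<open>m\<close> the last
    added term \<open>a m\<close> is kept in reserve to pay for the subtraction of
    \<open>a (m + 1)\<close>.\<close>
  have claim: "y\<^sup>2 / 12 + (if odd m then a m else 0) \<le> P m" if "m \<ge> 2" for m
    using that
  proof (induction m rule: nat_induct_at_least)
    \<comment> \<open>The constant arises from \<open>y^4 / 24 <= 10 * y^2 / 24\<close> and
      \<open>1/2 - 10/24 = 1/12\<close>.\<close>
    case base
    have "y\<^sup>2 * y\<^sup>2 \<le> y\<^sup>2 * 10" using assms(1) by (intro mult_left_mono) auto
    then have "y ^ 4 \<le> 10 * y\<^sup>2" by (simp flip: power_add)
    moreover have "a 2 = y ^ 4 / 24" by (simp add: a_def fact_numeral)
    moreover have "P 2 = a 1 - a 2" by (simp add: P_def numeral_2_eq_2)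
    ultimately show ?case using a1 by simp
  next
    case (Suc m)
    then show ?case using decr[OF Suc.hyps] P_Suc[of m] by (cases "odd m") auto
  qed
  have "y\<^sup>2 / 12 \<le> P m"
  proof (cases "m = 1")
    case True
    have "P 1 = a 1" by (simp add: P_def)
    then show ?thesis using a1 zero_le_power2[of y] unfolding True by linarith
  next
    case False
    then show ?thesis
      using assms(2) claim[of m] a_nonneg[of m] by (auto split: if_splits)
  qed
  then show ?thesis by (simp add: P_def a_def)
qed

section \<open>The orders of psi, p_m and f - f_m\<close>

lemma psi_eq: "N > 0 \<Longrightarrow> psi N s x = 1 / real N * (\<Sum>l=1..N. 1 - cos (coord_vec (s l) \<bullet> x))"
  by (simp add: psi_def sum_subtractf algebra_simps diff_divide_distrib)

lemma symbol_psi: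
  assumes "0 \<notin> A" "N > 0"
  shows "symbol A 2 (psi N s)"
proof -
  have "symbol A 2 (\<lambda>x. 1 / real N * (\<Sum>l=1..N. - 1 * cos_rem 0 (coord_vec (s l) \<bullet> x)))"
    using symbol_cos_rem[OF assms(1), of 0] by (intro symbol_cmult symbol_sum) simp
  moreover have "psi N s = (\<lambda>x. 1 / real N * (\<Sum>l=1..N. - 1 * cos_rem 0 (coord_vec (s l) \<bullet> x)))"
    using assms(2) by (auto simp: psi_eq cos_rem_def)
  ultimately show ?thesis by simp
qed

lemma symbol_p_trunc_minus_psi:
  assumes "0 \<notin> A" "N > 0"
  shows "symbol A (real (2 * m) + 2) (\<lambda>x. p_trunc N s m x - psi N s x)"
proof -
  have "symbol A (real (2 * m) + 2) (\<lambda>x. 1 / real N * (\<Sum>l=1..N. cos_rem m (coord_vec (s l) \<bullet> x)))"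
    using symbol_cos_rem[OF assms(1), of m] by (intro symbol_cmult symbol_sum)
  moreover have "(\<lambda>x. p_trunc N s m x - psi N s x) = (\<lambda>x. 1 / real N * (\<Sum>l=1..N. cos_rem m (coord_vec (s l) \<bullet> x)))"
    using assms(2) by (auto simp: psi_eq p_trunc_def cos_rem_def sum_subtractf right_diff_distrib)
  ultimately show ?thesis by simp
qed

text \<open>Only the terms \<open>l = 1\<close> and \<open>l = 2\<close> are kept; their arguments
  are the two coordinates of \<open>x\<close>, so together they control the full norm. This is where
  the basis vectors among the frequencies enter.\<close>

lemma average_ge:
  assumes "N \<ge> 2" "s 1 = (1, 0)" "s 2 = (0, 1)" "\<And>l. l \<in> {1..N} \<Longrightarrow> 0 \<le> q (coord_vec (s l) \<bullet> x)"
    and "c * (fst x)\<^sup>2 \<le> q (fst x)" "c * (snd x)\<^sup>2 \<le> q (snd x)"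
  shows "c / real N * (norm x)\<^sup>2 \<le> 1 / real N * (\<Sum>l=1..N. q (coord_vec (s l) \<bullet> x))"
proof -
  have "c * (norm x)\<^sup>2 = c * (fst x)\<^sup>2 + c * (snd x)\<^sup>2"
    by (simp add: norm_prod_def distrib_left)
  also have "\<dots> \<le> (\<Sum>l\<in>{1,2}. q (coord_vec (s l) \<bullet> x))"
    using assms(2,3,5,6) by (simp add: coord_vec_def inner_prod_def)
  also have "\<dots> \<le> (\<Sum>l=1..N. q (coord_vec (s l) \<bullet> x))"
    using assms(1,4) by (intro sum_mono2) auto
  finally show ?thesis by (simp add: divide_right_mono)
qed

abbreviation punctured_square :: "real \<Rightarrow> (real \<times> real) set" where
  "punctured_square R \<equiv> {x. x \<noteq> 0 \<and> \<bar>fst x\<bar> < R \<and> \<bar>snd x\<bar> < R}"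

lemma open_punctured_square: "open (punctured_square R)"
  by (intro open_Collect_conj open_Collect_neq open_Collect_less continuous_intros)

lemma psi_ge:
  assumes "N \<ge> 2" "s 1 = (1, 0)" "s 2 = (0, 1)" "x \<in> punctured_square (3 * pi / 2)"
  shows "1 / 400 / real N * norm x powr 2 \<le> psi N s x"
  using average_ge[OF assms(1-3), of "\<lambda>y. 1 - cos y" x "1 / 400"] one_minus_cos_ge[of "fst x"]
    one_minus_cos_ge[of "snd x"] assms(1,4) by (simp add: psi_eq)

lemma symbol_f_full:
  assumes "N \<ge> 2" "s 1 = (1, 0)" "s 2 = (0, 1)" "A \<subseteq> punctured_square (3 * pi / 2)"
  shows "symbol A (- 2) (f_full N s)"
  unfolding f_full_def[abs_def]
  by (rule symbol_inverse[OF symbol_psi, of _ _ "1 / 400 / real N"]) (use assms psi_ge in auto)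

text \<open>Rests on \<open>f - f_m = (p_m - psi) * f * f_m\<close>, of order
  \<open>(2 * m + 2) - 2 - 2\<close>. The lower bound on \<open>p_m\<close> is a hypothesis because
  the two regions obtain it differently.\<close>

lemma symbol_f_full_minus_f_trunc:
  assumes Ns: "N \<ge> 2" "s 1 = (1, 0)" "s 2 = (0, 1)" and R: "R \<le> 3 * pi / 2"
    and c: "c > 0" "\<And>x. x \<in> punctured_square R \<Longrightarrow> c * norm x powr 2 \<le> p_trunc N s m x"
  shows "symbol (punctured_square R) (-2) (f_trunc N s m)"
    and "symbol (punctured_square R) (real (2 * m) - 2) (\<lambda>x. f_full N s x - f_trunc N s m x)"
proof -
  let ?A = "punctured_square R"
  have A: "?A \<subseteq> punctured_square (3 * pi / 2)" "0 \<notin> ?A" using R by auto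
  have N: "N > 0" using Ns by simp
  let ?R = "\<lambda>x. p_trunc N s m x - psi N s x"
  have symR: "symbol ?A (real (2 * m) + 2) ?R"
    by (rule symbol_p_trunc_minus_psi[OF A(2) N])
  \<comment> \<open>On the bounded square the remainder also has order 2, hence so does
    \<open>p_m\<close>, being psi plus the remainder.\<close>
  have "norm x powr (real (2 * m) + 2 - 2) \<le> (2 * R) powr (real (2 * m))" if "x \<in> ?A" for x
  proof -
    have "norm x \<le> \<bar>fst x\<bar> + \<bar>snd x\<bar>"
      using norm_Pair_le[of "fst x" "snd x"] by simp
    then have "norm x \<le> 2 * R" using that by auto
    then show ?thesis by (simp add: powr_mono2)
  qed
  then have "symbol ?A 2 ?R"
    by (rule symbol_change_order[OF symR])
  then have "symbol ?A 2 (\<lambda>x. psi N s x + ?R x)"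
    by (intro symbol_add symbol_psi[OF A(2) N])
  then have "symbol ?A 2 (p_trunc N s m)" by simp
  then show f: "symbol ?A (-2) (f_trunc N s m)"
    unfolding f_trunc_def[abs_def] by (rule symbol_inverse[OF _ c(1) A(2) c(2)])
  have "symbol ?A (real (2 * m) + 2 + - 2 + - 2) (\<lambda>x. ?R x * f_full N s x * f_trunc N s m x)"
    by (intro symbol_mult symR symbol_f_full[OF Ns A(1)] f)
  then have "symbol ?A (real (2 * m) - 2) (\<lambda>x. ?R x * f_full N s x * f_trunc N s m x)"
    by (simp add: add.assoc)
  then show "symbol ?A (real (2 * m) - 2) (\<lambda>x. f_full N s x - f_trunc N s m x)"
  proof (rule symbol_cong_open[OF _ open_punctured_square])
    fix x assume x: "x \<in> ?A"
    then have "norm x powr 2 > 0" by simp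
    then have "0 < 1 / 400 / real N * norm x powr 2" "0 < c * norm x powr 2"
      using N c(1) by (auto intro!: mult_pos_pos)
    then have "psi N s x > 0" "p_trunc N s m x > 0"
      using psi_ge[OF Ns, of x] c(2)[OF x] A(1) x by (blast intro: less_le_trans)+
    then show "?R x * f_full N s x * f_trunc N s m x = f_full N s x - f_trunc N s m x"
      by (simp add: f_full_def f_trunc_def field_simps)
  qed
qed

section \<open>Lower bounds and the two grid regions\<close>

text \<open>\<open>p_1\<close> is a positive definite quadratic form, so the bound holds off the
  origin without any restriction on size; this is what admits \<open>f_1\<close> on all of
  \<open>D_n\<close>.\<close>

lemma p_trunc_1_ge:
  assumes "N \<ge> 2" "s 1 = (1, 0)" "s 2 = (0, 1)" "x \<noteq> 0"
  shows "1 / 2 / real N * norm x powr 2 \<le> p_trunc N s 1 x"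
  using average_ge[OF assms(1-3), of "\<lambda>y. y\<^sup>2 / 2" x "1 / 2"] assms(4)
  by (simp add: p_trunc_def fact_2)

lemma norm_coord_vec_le_s_max: "l \<in> {1..N} \<Longrightarrow> norm (coord_vec (s l)) \<le> s_max N s"
  unfolding s_max_def by (rule Max_ge) auto

lemma s_max_ge_1:
  assumes "N \<ge> 2" "s 1 = (1, 0)"
  shows "s_max N s \<ge> 1"
  using norm_coord_vec_le_s_max[of 1 N s] assms by (simp add: coord_vec_def norm_Pair)

text \<open>For even \<open>m\<close> the polynomial \<open>p_m\<close> becomes negative far out,
  hence the small square. There \<open>s_max^2 * |x|^2 <= 10\<close>, so by Cauchy-Schwarz every
  frequency falls into the range of \<open>cos_taylor_ge\<close>.\<close>

lemma p_trunc_ge: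
  assumes Ns: "N \<ge> 2" "s 1 = (1, 0)" "s 2 = (0, 1)" and m: "m \<ge> 1"
    and x: "x \<in> punctured_square (sqrt 5 / s_max N s)"
  shows "1 / 12 / real N * norm x powr 2 \<le> p_trunc N s m x"
proof -
  have S: "s_max N s \<ge> 1" by (rule s_max_ge_1[of N s, OF Ns(1,2)])
  have sq: "\<bar>y\<bar>\<^sup>2 \<le> 5 / (s_max N s)\<^sup>2" if "\<bar>y\<bar> < sqrt 5 / s_max N s" for y
    using power_mono[of "\<bar>y\<bar>" "sqrt 5 / s_max N s" 2] that by (simp add: power_divide)
  have "(norm x)\<^sup>2 \<le> 10 / (s_max N s)\<^sup>2"
    using x sq[of "fst x"] sq[of "snd x"] by (simp add: norm_prod_def)
  then have nx: "(s_max N s)\<^sup>2 * (norm x)\<^sup>2 \<le> 10"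
    using S by (simp add: field_simps)
  have le: "(coord_vec (s l) \<bullet> x)\<^sup>2 \<le> 10" if "l \<in> {1..N}" for l
  proof -
    have "\<bar>coord_vec (s l) \<bullet> x\<bar> \<le> s_max N s * norm x"
      using Cauchy_Schwarz_ineq2[of "coord_vec (s l)" x] norm_coord_vec_le_s_max[OF that, of s]
      by (meson mult_right_mono norm_ge_zero order_trans)
    from power_mono[OF this, of 2] show ?thesis
      using nx by (simp add: power_mult_distrib)
  qed
  let ?q = "\<lambda>y. \<Sum>j=1..m. (- 1) ^ (j + 1) * y ^ (2 * j) / fact (2 * j) :: real"
  have q: "1 / 12 * (coord_vec (s l) \<bullet> x)\<^sup>2 \<le> ?q (coord_vec (s l) \<bullet> x)" if "l \<in> {1..N}" for l
    using cos_taylor_ge[OF le[OF that] m] by simp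
  have "1 / 12 / real N * (norm x)\<^sup>2 \<le> 1 / real N * (\<Sum>l=1..N. ?q (coord_vec (s l) \<bullet> x))"
  proof (rule average_ge[OF Ns])
    show "0 \<le> ?q (coord_vec (s l) \<bullet> x)" if "l \<in> {1..N}" for l
      using q[OF that] by (rule order_trans[rotated]) simp
    show "1 / 12 * (fst x)\<^sup>2 \<le> ?q (fst x)" "1 / 12 * (snd x)\<^sup>2 \<le> ?q (snd x)"
      using q[of 1] q[of 2] Ns by (simp_all add: coord_vec_def inner_prod_def)
  qed
  then show ?thesis using x by (simp add: p_trunc_def)
qed

section \<open>Index sets of the two grid regions\<close>

definition full_indices :: "nat \<Rightarrow> (int \<times> int) set" where
  "full_indices n = {p. node n p \<in> {-pi..<pi} \<times> {-pi..<pi} - {0}}"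

definition square_indices :: "real \<Rightarrow> nat \<Rightarrow> (int \<times> int) set" where
  "square_indices r n = {p. \<bar>t_pt n (fst p)\<bar> \<le> r \<and> \<bar>t_pt n (snd p)\<bar> \<le> r \<and> node n p \<noteq> 0}"

lemma Union_cells_eq:
  "\<Union> {cell n j k | j k. P j k} = (\<Union>p\<in>{p. P (fst p) (snd p)}. node_cell n p)"
proof (rule set_eqI)
  fix x
  have "x \<in> \<Union> {cell n j k | j k. P j k} \<longleftrightarrow> (\<exists>j k. P j k \<and> x \<in> cell n j k)"
    by blast
  also have "\<dots> \<longleftrightarrow> (\<exists>p. P (fst p) (snd p) \<and> x \<in> node_cell n p)"
    by (simp add: split_paired_Ex)
  also have "\<dots> \<longleftrightarrow> x \<in> (\<Union>p\<in>{p. P (fst p) (snd p)}. node_cell n p)"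
    by blast
  finally show "x \<in> \<Union> {cell n j k | j k. P j k} \<longleftrightarrow> x \<in> (\<Union>p\<in>{p. P (fst p) (snd p)}. node_cell n p)" .
qed

lemma D_full_eq: "D_full n = (\<Union>p\<in>full_indices n. node_cell n p)"
  unfolding D_full_def full_indices_def by (simp only: Union_cells_eq)

lemma D_beta_eq: "D_beta N s \<beta> n = (\<Union>p\<in>square_indices (sqrt (5 * (1 - \<beta>)) / s_max N s) n. node_cell n p)"
  unfolding D_beta_def square_indices_def t_grid_def zero_prod_def by (simp only: Union_cells_eq)

lemma square_indices_subset_full_indices: "r < pi \<Longrightarrow> square_indices r n \<subseteq> full_indices n"
  by (auto simp: square_indices_def full_indices_def t_grid_def)

lemma full_indices_subset:
  assumes "n > 0"
  shows "full_indices n \<subseteq> index_box n - {0}"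
proof
  fix p assume p: "p \<in> full_indices n"
  have *: "\<bar>j\<bar> \<le> int n" if "\<bar>t_pt n j\<bar> \<le> pi" for j
  proof -
    have "pi * (2 * real_of_int \<bar>j\<bar>) \<le> pi * real n"
      using that assms by (simp add: t_pt_def abs_mult field_simps)
    then have "2 * real_of_int \<bar>j\<bar> \<le> real n"
      by (simp only: mult_le_cancel_left_pos[OF pi_gt_zero])
    then show ?thesis by linarith
  qed
  have "\<bar>t_pt n (fst p)\<bar> \<le> pi" "\<bar>t_pt n (snd p)\<bar> \<le> pi"
    using p by (auto simp: full_indices_def t_grid_def)
  from this[THEN *] have "p \<in> index_box n" by (cases p) (auto simp: index_box_def)
  moreover have "p \<noteq> 0" using p by (auto simp: full_indices_def t_grid_def t_pt_def zero_prod_def)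
  ultimately show "p \<in> index_box n - {0}" by simp
qed

lemma node_cell_subset_punctured_square:
  assumes "n > 0" "p \<in> square_indices r n" "r + pi / real n < R"
  shows "node_cell n p \<subseteq> punctured_square R"
proof
  fix x assume x: "x \<in> node_cell n p"
  have p: "p \<noteq> 0" using assms(2) by (auto simp: square_indices_def t_grid_def t_pt_def zero_prod_def)
  have "0 < pi / real n * sup_index p"
    using assms(1) sup_index_ge_1[OF p] by (intro mult_pos_pos) auto
  then have "x \<noteq> 0" using norm_node_cell_ge[OF assms(1) p x] by auto
  then show "x \<in> punctured_square R"
    using x assms(2,3) by (auto simp: mem_node_cell square_indices_def)
qed

lemma full_indices_subset_square_indices: "full_indices n \<subseteq> square_indices pi n"
  by (auto simp: square_indices_def full_indices_def t_grid_def)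

lemma node_cell_full_indices:
  assumes "n \<ge> 3" "p \<in> full_indices n"
  shows "node_cell n p \<subseteq> punctured_square (3 * pi / 2)"
proof (rule node_cell_subset_punctured_square)
  \<comment> \<open>From \<open>n = 3\<close> on the half-width is below \<open>pi / 2\<close>,
    which keeps the cells within the range of \<open>one_minus_cos_ge\<close>.\<close>
  have "pi / real n \<le> pi / 3" using assms(1) by (intro divide_left_mono) auto
  also have "\<dots> < pi / 2" by simp
  finally show "pi + pi / real n < 3 * pi / 2" by simp
qed (use assms full_indices_subset_square_indices in auto)

lemma independent_pair_eq_0:
  fixes v w :: "'v::real_vector"
  assumes "independent {v, w}" "v \<noteq> w" "a *\<^sub>R v + c *\<^sub>R w = 0"
  shows "a = 0" "c = 0"
proof -
  have *: "(\<Sum>x\<in>{v, w}. (if x = v then a else c) *\<^sub>R x) = 0"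
    using assms(2,3) by simp
  show "a = 0" "c = 0"
    using independentD[OF assms(1) _ subset_refl *, of v] independentD[OF assms(1) _ subset_refl *, of w] assms(2)
    by auto
qed

lemma bigoI_sequentially:
  fixes f g :: "nat \<Rightarrow> real"
  assumes "\<And>n. n \<ge> n0 \<Longrightarrow> norm (f n) \<le> c * norm (g n)"
  shows "f \<in> O(g)"
  by (rule bigoI[of _ c]) (use assms in \<open>auto simp: eventually_sequentially\<close>)

text \<open>Absorbs the additive constant in the logarithmic bounds, since 3 exceeds e.\<close>

lemma one_plus_ln_le: "n \<ge> 3 \<Longrightarrow> 1 + ln (real n) \<le> 2 * ln (real n)"
proof -
  assume "n \<ge> 3"
  then have "ln (exp 1) \<le> ln (real n)" using exp_le by (subst ln_le_cancel_iff) auto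
  then show ?thesis by simp
qed

theorem theorem2:
  fixes b :: "nat \<Rightarrow> 'v::real_vector" and N :: nat and s :: "nat \<Rightarrow> int \<times> int"
  assumes "dim (UNIV :: 'v set) = 2"
    and "N \<ge> 2"
    and "\<forall>l\<in>{1..N}. b l \<noteq> 0"
    and "full_rank_lattice (group_closure (b ` {1..N}))"
    and "b 1 \<noteq> b 2"
    and "lattice_basis {b 1, b 2} (group_closure (b ` {1..N}))"
    and "\<forall>l\<in>{1..N}. b l = real_of_int (fst (s l)) *\<^sub>R b 1 + real_of_int (snd (s l)) *\<^sub>R b 2"
  shows "(\<lambda>n. F_full n (f_full N s) - I_full n (f_full N s)
            + I_full n (f_trunc N s 1) - F_full n (f_trunc N s 1)) \<in> O(\<lambda>n. ln (real n))
    \<and> (\<forall>\<beta> m. 0 < \<beta> \<and> \<beta> < 1 \<and> m \<ge> 1 \<longrightarrow>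
          (\<lambda>n. F_full n (f_full N s) - I_full n (f_full N s)
            + I_beta N s \<beta> n (f_trunc N s m) - F_beta N s \<beta> n (f_trunc N s m))
          \<in> (if m = 1 then O(\<lambda>n. ln (real n)) else O(\<lambda>n. 1)))"
proof -
  have ind: "independent {b 1, b 2}" using assms(6) by (simp add: lattice_basis_def)
  have l12: "1 \<in> {1..N}" "2 \<in> {1..N}" using assms(2) by auto
  \<comment> \<open>The values of \<open>s 1\<close> and \<open>s 2\<close> follow from uniqueness
    of coordinates: two representations of the same basis vector differ by a vanishing
    combination.\<close>
  have "(real_of_int (fst (s 1)) - 1) *\<^sub>R b 1 + real_of_int (snd (s 1)) *\<^sub>R b 2
      = (real_of_int (fst (s 1)) *\<^sub>R b 1 + real_of_int (snd (s 1)) *\<^sub>R b 2) - b 1"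
    by (simp add: algebra_simps)
  also have "\<dots> = 0"
    unfolding right_minus_eq by (rule bspec[OF assms(7) l12(1), symmetric])
  finally have e1: "(real_of_int (fst (s 1)) - 1) *\<^sub>R b 1 + real_of_int (snd (s 1)) *\<^sub>R b 2 = 0" .
  have s1: "s 1 = (1, 0)"
    using independent_pair_eq_0[OF ind assms(5) e1] by (simp add: prod_eq_iff)
  have "real_of_int (fst (s 2)) *\<^sub>R b 1 + (real_of_int (snd (s 2)) - 1) *\<^sub>R b 2
      = (real_of_int (fst (s 2)) *\<^sub>R b 1 + real_of_int (snd (s 2)) *\<^sub>R b 2) - b 2"
    by (simp add: algebra_simps)
  also have "\<dots> = 0"
    unfolding right_minus_eq by (rule bspec[OF assms(7) l12(2), symmetric])
  finally have e2: "real_of_int (fst (s 2)) *\<^sub>R b 1 + (real_of_int (snd (s 2)) - 1) *\<^sub>R b 2 = 0" .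
  have s2: "s 2 = (0, 1)"
    using independent_pair_eq_0[OF ind assms(5) e2] by (simp add: prod_eq_iff)
  note Ns = assms(2) s1 s2
  let ?f = "f_full N s"
  let ?A = "punctured_square (3 * pi / 2)"
  have sym_f: "symbol ?A (- 2) ?f" by (rule symbol_f_full[OF Ns]) simp
  have fin: "finite (full_indices n)" if "n > 0" for n
    by (rule finite_subset[OF order_trans[OF full_indices_subset[OF that] Diff_subset] finite_index_box])
  have full: "F_full n g - I_full n g = (\<Sum>p\<in>full_indices n. quad_err n g p)"
    if "n \<ge> 3" "continuous_on ?A g" for n g
    unfolding F_full_def I_full_def D_full_eq
  proof (rule grid_sum_minus_grid_int)
    show "continuous_on (node_cell n p) g" if "p \<in> full_indices n" for p
      using \<open>continuous_on ?A g\<close> node_cell_full_indices[OF \<open>n \<ge> 3\<close> that] by (rule continuous_on_subset)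
  qed (use fin that(1) in auto)

  have "(\<lambda>n. F_full n ?f - I_full n ?f + I_full n (f_trunc N s 1) - F_full n (f_trunc N s 1)) \<in> O(\<lambda>n. ln (real n))"
  proof -
    \<comment> \<open>For \<open>m = 1\<close> the lower bound allows the largest square, with
      \<open>R = 3 * pi / 2\<close>, so \<open>f\<close> and \<open>f_1\<close> are compared on all
      cells.\<close>
    note sym = symbol_f_full_minus_f_trunc[OF Ns order_refl, of "1 / 2 / real N" 1]
    have c: "1 / 2 / real N > 0" using Ns(1) by simp
    have sym1: "symbol ?A (- 2) (f_trunc N s 1)"
      and sym0: "symbol ?A 0 (\<lambda>x. ?f x - f_trunc N s 1 x)"
      using sym[OF c] p_trunc_1_ge[OF Ns] by simp_all
    obtain C where C: "C \<ge> 0" "\<forall>n>0. \<forall>T. T \<subseteq> index_box n - {0} \<longrightarrow> (\<forall>p\<in>T. node_cell n p \<subseteq> ?A)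
          \<longrightarrow> \<bar>\<Sum>p\<in>T. quad_err n (\<lambda>x. ?f x - f_trunc N s 1 x) p\<bar> \<le> C * (1 + ln (real n))"
      by (rule sum_quad_err_symbol_0[OF sym0])
    have "norm (F_full n ?f - I_full n ?f + I_full n (f_trunc N s 1) - F_full n (f_trunc N s 1))
        \<le> C * 2 * norm (ln (real n))" if n: "n \<ge> 3" for n
    proof -
      have "F_full n ?f - I_full n ?f + I_full n (f_trunc N s 1) - F_full n (f_trunc N s 1)
          = (\<Sum>p\<in>full_indices n. quad_err n ?f p - quad_err n (f_trunc N s 1) p)"
        using full[OF n symbol_continuous[OF sym_f]] full[OF n symbol_continuous[OF sym1]]
        by (simp add: sum_subtractf)
      also have "\<dots> = (\<Sum>p\<in>full_indices n. quad_err n (\<lambda>x. ?f x - f_trunc N s 1 x) p)"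
      proof (intro sum.cong refl quad_err_diff[symmetric])
        fix p assume "p \<in> full_indices n"
        note sub = node_cell_full_indices[OF n this]
        show "continuous_on (node_cell n p) ?f"
          by (rule continuous_on_subset[OF symbol_continuous[OF sym_f] sub])
        show "continuous_on (node_cell n p) (f_trunc N s 1)"
          by (rule continuous_on_subset[OF symbol_continuous[OF sym1] sub])
      qed
      also have "\<bar>\<dots>\<bar> \<le> C * (1 + ln (real n))"
        using n full_indices_subset[of n] node_cell_full_indices[OF n] by (intro C(2)[rule_format]) auto
      also have "\<dots> \<le> C * (2 * ln (real n))"
        using one_plus_ln_le[OF n] C(1) by (intro mult_left_mono) auto
      finally show ?thesis using n by simp
    qed
    then show ?thesis
      by (rule bigoI_sequentially)
  qed
  moreover have "(\<lambda>n. F_full n ?f - I_full n ?f + I_beta N s \<beta> n (f_trunc N s m) - F_beta N s \<beta> n (f_trunc N s m))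
          \<in> (if m = 1 then O(\<lambda>n. ln (real n)) else O(\<lambda>n. 1))"
    if "0 < \<beta>" "\<beta> < 1" "m \<ge> 1" for \<beta> m
  proof -
    define S where "S = s_max N s"
    \<comment> \<open>Nodes of the small region have coordinates up to \<open>r\<close>, while
      \<open>p_m\<close> is bounded below up to \<open>R\<close>. As \<open>\<beta>\<close> is
      positive, \<open>r < R\<close> leaves room for the half-width of the cells;
      \<open>\<beta> < 1\<close> gives \<open>r > 0\<close>.\<close>
    define r where "r = sqrt (5 * (1 - \<beta>)) / S"
    define R where "R = sqrt 5 / S"
    have S: "S \<ge> 1" unfolding S_def by (rule s_max_ge_1[of N s, OF Ns(1,2)])
    have r: "0 < r" "r < R"
      using S that by (auto simp: r_def R_def divide_strict_right_mono)
    have "sqrt 5 < sqrt 9" by (rule real_sqrt_less_mono) simp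
    then have "sqrt 5 < 3" by simp
    moreover have "R \<le> sqrt 5" using S by (simp add: R_def divide_le_eq)
    ultimately have R: "R < pi" using pi_gt3 by linarith
    let ?g = "f_trunc N s m" and ?B = "punctured_square R"
    \<comment> \<open>Cells outside the small region will lie here. Away from the origin the order
      -2 of \<open>f\<close> may be raised to 2, so these cells have bounded total error without any
      correction term.\<close>
    let ?A' = "{x \<in> ?A. r / 2 < norm x}"
    let ?d = "\<lambda>x. ?f x - ?g x"
    have c: "1 / 12 / real N > 0" using Ns(1) by simp
    have R': "R \<le> 3 * pi / 2" using R pi_gt_zero by linarith
    then have sub: "?B \<subseteq> ?A" by auto
    note sym = symbol_f_full_minus_f_trunc[OF Ns R' c, of m]
    have sym_g: "symbol ?B (- 2) ?g" and sym_d: "symbol ?B (real (2 * m) - 2) ?d"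
      using sym p_trunc_ge[OF Ns that(3)] by (simp_all add: R_def S_def)
    have away: "norm x powr (- 2 - 2) \<le> (r / 2) powr (- 4)" if "x \<in> ?A'" for x
      using that r by (simp add: powr_mono2')
    have "symbol ?A' (- 2) ?f"
      by (rule symbol_subset[OF sym_f]) blast
    then have sym_f': "symbol ?A' 2 ?f"
      using away by (rule symbol_change_order)
    obtain C where C: "C \<ge> 0" "\<forall>n>0. \<forall>T. T \<subseteq> index_box n \<longrightarrow> (\<forall>p\<in>T. node_cell n p \<subseteq> ?A')
          \<longrightarrow> \<bar>\<Sum>p\<in>T. quad_err n ?f p\<bar> \<le> C"
      by (rule sum_quad_err_symbol_2[OF sym_f'])
    \<comment> \<open>From \<open>n0\<close> on, \<open>pi / n\<close> is below
      \<open>R - r\<close>, which keeps the cells of \<open>T n\<close> inside \<open>?B\<close>,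
      and below \<open>r / 2\<close>, which keeps the remaining ones away from the origin.\<close>
    obtain n0 :: nat where n0: "pi / min (R - r) (r / 2) < real n0"
      using reals_Archimedean2 by blast
    define T where "T = square_indices r"
    have main: "\<bar>F_full n ?f - I_full n ?f + I_beta N s \<beta> n ?g - F_beta N s \<beta> n ?g\<bar>
        \<le> C + \<bar>\<Sum>p\<in>T n. quad_err n ?d p\<bar>"
      and cells: "T n \<subseteq> index_box n - {0}" "\<forall>p\<in>T n. node_cell n p \<subseteq> ?B"
      if n: "n \<ge> max 3 n0" for n
    proof -
      have n': "n > 0" "n \<ge> 3" using n by auto
      have "pi / min (R - r) (r / 2) < real n" using n0 n by linarith
      moreover have "min (R - r) (r / 2) > 0" using r by simp
      ultimately have "pi / real n < min (R - r) (r / 2)"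
        using n'(1) by (metis divide_less_eq mult.commute of_nat_0_less_iff)
      then have small: "r + pi / real n < R" "pi / real n < r / 2" by auto
      have TF: "T n \<subseteq> full_indices n"
        unfolding T_def using r R by (intro square_indices_subset_full_indices) simp
      then show "T n \<subseteq> index_box n - {0}" using full_indices_subset[OF n'(1)] by blast
      show cells: "\<forall>p\<in>T n. node_cell n p \<subseteq> ?B"
        unfolding T_def using node_cell_subset_punctured_square[OF n'(1) _ small(1)] by blast
      have cont: "continuous_on (node_cell n p) ?f" "continuous_on (node_cell n p) ?g" if "p \<in> T n" for p
      proof -
        have B: "node_cell n p \<subseteq> ?B" using cells that by blast
        show "continuous_on (node_cell n p) ?f"
          by (rule continuous_on_subset[OF symbol_continuous[OF sym_f] order_trans[OF B sub]])
        show "continuous_on (node_cell n p) ?g"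
          by (rule continuous_on_subset[OF symbol_continuous[OF sym_g] B])
      qed
      have finT: "finite (T n)" using TF fin[OF n'(1)] by (rule finite_subset)
      have beta: "F_beta N s \<beta> n ?g - I_beta N s \<beta> n ?g = (\<Sum>p\<in>T n. quad_err n ?g p)"
        unfolding F_beta_def I_beta_def D_beta_eq
        using grid_sum_minus_grid_int[OF n'(1) finT cont(2)] by (simp add: T_def r_def S_def)
      \<comment> \<open>On \<open>T n\<close> the errors of \<open>f\<close> and \<open>f_m\<close>
        combine into the error of their difference; the other cells carry \<open>f\<close>
        alone.\<close>
      have "F_full n ?f - I_full n ?f = (\<Sum>p\<in>full_indices n - T n. quad_err n ?f p) + (\<Sum>p\<in>T n. quad_err n ?f p)"
        using full[OF n'(2) symbol_continuous[OF sym_f]] sum.subset_diff[OF TF fin[OF n'(1)]] by simp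
      moreover have "(\<Sum>p\<in>T n. quad_err n ?d p) = (\<Sum>p\<in>T n. quad_err n ?f p) - (\<Sum>p\<in>T n. quad_err n ?g p)"
        using quad_err_diff[OF cont] by (simp flip: sum_subtractf)
      moreover have "\<bar>\<Sum>p\<in>full_indices n - T n. quad_err n ?f p\<bar> \<le> C"
      proof (rule C(2)[rule_format, OF n'(1)])
        show "full_indices n - T n \<subseteq> index_box n" using full_indices_subset[OF n'(1)] by blast
        fix p assume p: "p \<in> full_indices n - T n"
        show "node_cell n p \<subseteq> ?A'"
        proof
          fix x assume x: "x \<in> node_cell n p"
          \<comment> \<open>The node is nonzero, so it can only fail to be in the small square
            through a coordinate beyond \<open>r\<close>; the half-width costs less than
            \<open>r / 2\<close>.\<close>
          have "r < \<bar>t_pt n (fst p)\<bar> \<or> r < \<bar>t_pt n (snd p)\<bar>"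
            using p by (auto simp: T_def square_indices_def full_indices_def)
          then have "r / 2 < \<bar>fst x\<bar> \<or> r / 2 < \<bar>snd x\<bar>"
            using x small(2) unfolding mem_node_cell by linarith
          moreover have "\<bar>fst x\<bar> \<le> norm x" "\<bar>snd x\<bar> \<le> norm x"
            using norm_fst_le[of "fst x" "snd x"] norm_snd_le[of "snd x" "fst x"] by auto
          ultimately have "r / 2 < norm x" by linarith
          then show "x \<in> ?A'" using node_cell_full_indices[OF n'(2), of p] p x by blast
        qed
      qed
      ultimately show "\<bar>F_full n ?f - I_full n ?f + I_beta N s \<beta> n ?g - F_beta N s \<beta> n ?g\<bar>
          \<le> C + \<bar>\<Sum>p\<in>T n. quad_err n ?d p\<bar>"
        using beta by linarith
    qed
    show ?thesis
    proof (cases "m = 1")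
      case True
      have sym_d0: "symbol ?B 0 ?d" using sym_d True by simp
      obtain D where D: "D \<ge> 0" "\<forall>n>0. \<forall>T. T \<subseteq> index_box n - {0} \<longrightarrow> (\<forall>p\<in>T. node_cell n p \<subseteq> ?B)
          \<longrightarrow> \<bar>\<Sum>p\<in>T. quad_err n ?d p\<bar> \<le> D * (1 + ln (real n))"
        by (rule sum_quad_err_symbol_0[OF sym_d0])
      have "norm (F_full n ?f - I_full n ?f + I_beta N s \<beta> n ?g - F_beta N s \<beta> n ?g)
          \<le> (C + D) * 2 * norm (ln (real n))" if n: "n \<ge> max 3 n0" for n
      proof -
        have "\<bar>\<Sum>p\<in>T n. quad_err n ?d p\<bar> \<le> D * (1 + ln (real n))"
          using n cells[OF n] by (intro D(2)[rule_format]) auto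
        moreover have "C * 1 \<le> C * (1 + ln (real n))"
          using n C(1) by (intro mult_left_mono) auto
        ultimately have "norm (F_full n ?f - I_full n ?f + I_beta N s \<beta> n ?g - F_beta N s \<beta> n ?g)
            \<le> (C + D) * (1 + ln (real n))"
          using main[OF n] by (simp add: distrib_right)
        also have "\<dots> \<le> (C + D) * (2 * ln (real n))"
          using one_plus_ln_le[of n] n C(1) D(1) by (intro mult_left_mono) auto
        finally show ?thesis using n by (simp add: algebra_simps)
      qed
      then have "(\<lambda>n. F_full n ?f - I_full n ?f + I_beta N s \<beta> n ?g - F_beta N s \<beta> n ?g) \<in> O(\<lambda>n. ln (real n))"
        by (rule bigoI_sequentially)
      then show ?thesis using True by simp
    next
      case False
      \<comment> \<open>For \<open>m >= 2\<close> the exponent \<open>2 * m - 4\<close> is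
        nonnegative, so the difference has order 2. For \<open>m = 1\<close> the weight would be
        \<open>|x|^(-2)\<close>, which is unbounded near 0 and leads to the logarithm.\<close>
      have "norm x powr (real (2 * m) - 2 - 2) \<le> (2 * R) powr (real (2 * m) - 4)" if "x \<in> ?B" for x
      proof -
        have "norm x \<le> \<bar>fst x\<bar> + \<bar>snd x\<bar>"
          using norm_Pair_le[of "fst x" "snd x"] by simp
        then have "norm x \<le> 2 * R" using that by auto
        moreover have "real (2 * m) - 4 \<ge> 0" using False \<open>m \<ge> 1\<close> by simp
        ultimately show ?thesis by (simp add: powr_mono2)
      qed
      then have sym_d2: "symbol ?B 2 ?d" by (rule symbol_change_order[OF sym_d])
      obtain D where D: "D \<ge> 0" "\<forall>n>0. \<forall>T. T \<subseteq> index_box n \<longrightarrow> (\<forall>p\<in>T. node_cell n p \<subseteq> ?B)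
          \<longrightarrow> \<bar>\<Sum>p\<in>T. quad_err n ?d p\<bar> \<le> D"
        by (rule sum_quad_err_symbol_2[OF sym_d2])
      have "norm (F_full n ?f - I_full n ?f + I_beta N s \<beta> n ?g - F_beta N s \<beta> n ?g)
          \<le> (C + D) * norm (1 :: real)" if n: "n \<ge> max 3 n0" for n
      proof -
        have "\<bar>\<Sum>p\<in>T n. quad_err n ?d p\<bar> \<le> D"
          using n cells[OF n] by (intro D(2)[rule_format]) auto
        then show ?thesis using main[OF n] by simp
      qed
      then have "(\<lambda>n. F_full n ?f - I_full n ?f + I_beta N s \<beta> n ?g - F_beta N s \<beta> n ?g) \<in> O(\<lambda>n. 1)"
        by (rule bigoI_sequentially)
      then show ?thesis using False by simp
    qed
  qed
  ultimately show ?thesis by blast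
qed

end
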